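(* Let $K$ be a field, $P=K[x_1,\dots,x_n]$, $I\subset P$ a 0-dimensional ideal, and $R=P/I$. Then the following conditions are equivalent. (a) The ring $R$ has the Cayley-Bacharach property. (b) The $K$-bilinear multiplication map $R\otimes_K G_{-\mathrm{ri}(R)}\omega_R\longrightarrow \omega_R$, $f\otimes\varphi\mapsto f\cdot\varphi$, is non-degenerate. (c) We have $\mathrm{Ann}_R(G_{-\mathrm{ri}(R)}\omega_R)=\{0\}$.
   Context: Setting: $I$ is a proper ideal of $P=K[x_1,\dots,x_n]$ such that $\dim_K(P/I)<\infty$; $R=P/I$ is always considered with this fixed presentation. Degree filtration: $F_iP=\{f\in P\mid \deg f\le i\}\cup\{0\}$, $F_iI=F_iP\cap I$, and $F_iR=F_iP/F_iI$ is the image of $F_iP$ in $R$ ($i\in\mathbb Z$). $\mathrm{HF}^a_R(i)=\dim_K F_iR$. The regularity index is $\mathrm{ri}(R)=\min\{i\in\mathbb Z\mid \mathrm{HF}^a_R(j)=\dim_K R \text{ for all } j\ge i\}$. For $f\in R\setminus\{0\}$, $\mathrm{ord}_{\mathcal F}(f)=\min\{i\mid f\in F_iR\}$. Cayley-Bacharach property (CBP): let $I=\mathfrak Q_1\cap\dots\cap\mathfrak Q_s$ be the primary decomposition, $\mathfrak M_i=\mathrm{Rad}(\mathfrak Q_i)$ (maximal ideals), $\ell_i=\dim_K(P/\mathfrak M_i)$. A $\mathfrak Q_i$-divisor of $I$ is an ideal $J=\mathfrak Q_1\cap\dots\cap\mathfrak Q_i'\cap\dots\cap\mathfrak Q_s$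 ($\mathfrak Q_i$ replaced by $\mathfrak Q_i'$), where $\mathfrak Q_i'$ is an ideal of $P$ with $\mathfrak Q_i\subsetneq\mathfrak Q_i'$ (so $\mathfrak Q_i'\subseteq\mathfrak M_i$ or $\mathfrak Q_i'=P$). It is minimal if $\dim_K(J/I)=\ell_i$. For a minimal $\mathfrak Q_i$-divisor $J$ with image $\bar J=J/I$ in $R$, put $\mathrm{ri}(\bar J)=\max\{\mathrm{ord}_{\mathcal F}(f)\mid f\in\bar J\setminus\{0\}\}$. $R$ has the CBP if for every $i\in\{1,\dots,s\}$ and every minimal $\mathfrak Q_i$-divisor $J$ of $I$ we have $\mathrm{ri}(\bar J)=\mathrm{ri}(R)$. Canonical module: $\omega_R=\mathrm{Hom}_K(R,K)$ with $R$-module structure $(f\cdot\varphi)(g)=\varphi(fg)$. Its degree filtration is $G_i\omega_R=\{\varphi\in\omega_R\mid\varphi(F_{-i-1}R)=0\}$, $i\in\mathbb Z$. Non-degenerate means: if $f\in R$ satisfies $f\cdot\varphi=0$ for all $\varphi\in G_{-\mathrm{ri}(R)}\omega_R$ then $f=0$, and if $\varphi\in G_{-\mathrm{ri}(R)}\omega_R$ satisfies $f\cdot\varphi=0$ for all $f\in R$ then $\varphi=0$. *)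

theory Defs
  imports "HOL-Algebra.Algebra" "HOL-Algebra.Algebraic_Closure_Type" "HOL-Library.Poly_Mapping"
begin

section \<open>The polynomial ring and its residue class rings\<close>

text \<open>
  A power product in the indeterminates \<open>x\<^sub>i\<close>, \<open>i :: 'n\<close>, is its exponent vector of type
  \<open>'n \<Rightarrow>\<^sub>0 nat\<close>; a polynomial is a finitely supported function from power products to
  coefficients, and multiplication on this type is convolution.
\<close>

type_synonym ('n, 'k) mpoly = "('n \<Rightarrow>\<^sub>0 nat) \<Rightarrow>\<^sub>0 'k"

abbreviation polyring :: "('n::finite, 'k::field) mpoly ring"
  where "polyring \<equiv> ring_of_type_algebra"

definition const_poly :: "'k::field \<Rightarrow> ('n::finite, 'k) mpoly"
  where "const_poly c = Poly_Mapping.single 0 c"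

definition residue_class :: "('n::finite, 'k::field) mpoly set \<Rightarrow> ('n, 'k) mpoly \<Rightarrow> ('n, 'k) mpoly set"
  where "residue_class I f = I +>\<^bsub>polyring\<^esub> f"

text \<open>
  The image of \<open>K\<close> in \<open>P/I\<close>. Dimensions of subspaces of \<open>P/I\<close> are taken over this subfield with
  the dimension theory of \<^theory>\<open>HOL-Algebra.Embedded_Algebras\<close>.
\<close>

definition base_field :: "('n::finite, 'k::field) mpoly set \<Rightarrow> ('n, 'k) mpoly set set"
  where "base_field I = (\<lambda>c. residue_class I (const_poly c)) ` UNIV"

definition dimK :: "('n::finite, 'k::field) mpoly set \<Rightarrow> ('n, 'k) mpoly set set \<Rightarrow> nat"
  where "dimK I V = ring.dim (polyring Quot I) (base_field I) V"

definition zero_dimensional :: "('n::finite, 'k::field) mpoly set \<Rightarrow> bool"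
  where "zero_dimensional I \<longleftrightarrow>
    ring.finite_dimension (polyring Quot I) (base_field I) (carrier (polyring Quot I))"


section \<open>Degree filtration\<close>

text \<open>Total degree; only meaningful for nonzero polynomials.\<close>

definition total_degree :: "('n::finite, 'k::field) mpoly \<Rightarrow> nat"
  where "total_degree f =
    Max ((\<lambda>t. \<Sum>i\<in>UNIV. Poly_Mapping.lookup t i) ` Poly_Mapping.keys f)"

definition filtP :: "int \<Rightarrow> ('n::finite, 'k::field) mpoly set"
  where "filtP i = {f. f \<noteq> 0 \<and> int (total_degree f) \<le> i} \<union> {0}"

definition filtR :: "('n::finite, 'k::field) mpoly set \<Rightarrow> int \<Rightarrow> ('n, 'k) mpoly set set"
  where "filtR I i = residue_class I ` filtP i"

definition affine_HF :: "('n::finite, 'k::field) mpoly set \<Rightarrow> int \<Rightarrow> nat"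
  where "affine_HF I i = dimK I (filtR I i)"

definition reg_index :: "('n::finite, 'k::field) mpoly set \<Rightarrow> int"
  where "reg_index I =
    (LEAST i. \<forall>j\<ge>i. affine_HF I j = dimK I (carrier (polyring Quot I)))"

definition filt_ord :: "('n::finite, 'k::field) mpoly set \<Rightarrow> ('n, 'k) mpoly set \<Rightarrow> int"
  where "filt_ord I f = (LEAST i. f \<in> filtR I i)"


section \<open>Primary decomposition and the Cayley-Bacharach property\<close>

definition ideal_radical :: "('a, 'b) ring_scheme \<Rightarrow> 'a set \<Rightarrow> 'a set"
  where "ideal_radical R Q = {f \<in> carrier R. \<exists>m::nat. f [^]\<^bsub>R\<^esub> m \<in> Q}"

definition primary_ideal :: "('a, 'b) ring_scheme \<Rightarrow> 'a set \<Rightarrow> bool"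
  where "primary_ideal R Q \<longleftrightarrow> ideal Q R \<and> Q \<noteq> carrier R \<and>
    (\<forall>f\<in>carrier R. \<forall>g\<in>carrier R. f \<otimes>\<^bsub>R\<^esub> g \<in> Q \<longrightarrow> f \<in> Q \<or> g \<in> ideal_radical R Q)"

text \<open>
  \<open>\<Q>\<close> is the set of components of an irredundant primary decomposition of \<open>I\<close> with pairwise
  distinct radicals. For a proper zero-dimensional ideal there is exactly one such \<open>\<Q>\<close>.
\<close>

definition primary_decomposition ::
    "('n::finite, 'k::field) mpoly set \<Rightarrow> ('n, 'k) mpoly set set \<Rightarrow> bool"
  where "primary_decomposition I \<Q> \<longleftrightarrow> finite \<Q> \<and> (\<forall>Q\<in>\<Q>. primary_ideal polyring Q) \<and>
    \<Inter>\<Q> = I \<and> (\<forall>Q\<in>\<Q>. \<Inter>(\<Q> - {Q}) \<noteq> I) \<and> inj_on (ideal_radical polyring) \<Q>"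

text \<open>The intersection over the empty set of ideals is the whole polynomial ring.\<close>

definition is_divisor :: "('n::finite, 'k::field) mpoly set set \<Rightarrow> ('n, 'k) mpoly set \<Rightarrow>
    ('n, 'k) mpoly set \<Rightarrow> bool"
  where "is_divisor \<Q> Q J \<longleftrightarrow> (\<exists>Q'. ideal Q' polyring \<and> Q \<subset> Q' \<and> J = \<Inter>(\<Q> - {Q}) \<inter> Q')"

definition is_minimal_divisor :: "('n::finite, 'k::field) mpoly set \<Rightarrow> ('n, 'k) mpoly set set \<Rightarrow>
    ('n, 'k) mpoly set \<Rightarrow> ('n, 'k) mpoly set \<Rightarrow> bool"
  where "is_minimal_divisor I \<Q> Q J \<longleftrightarrow> is_divisor \<Q> Q J \<and>
    (let M = ideal_radical polyring Q
     in dimK I (residue_class I ` J) = dimK M (carrier (polyring Quot M)))"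

definition reg_index_ideal :: "('n::finite, 'k::field) mpoly set \<Rightarrow> ('n, 'k) mpoly set \<Rightarrow> int"
  where "reg_index_ideal I J =
    Max (filt_ord I ` (residue_class I ` J - {\<zero>\<^bsub>polyring Quot I\<^esub>}))"

definition cayley_bacharach :: "('n::finite, 'k::field) mpoly set \<Rightarrow> bool"
  where "cayley_bacharach I \<longleftrightarrow>
    (\<forall>\<Q>. primary_decomposition I \<Q> \<longrightarrow>
      (\<forall>Q\<in>\<Q>. \<forall>J. is_minimal_divisor I \<Q> Q J \<longrightarrow> reg_index_ideal I J = reg_index I))"


section \<open>The canonical module\<close>

definition linear_forms :: "('n::finite, 'k::field) mpoly set \<Rightarrow> (('n, 'k) mpoly set \<Rightarrow> 'k) set"
  where "linear_forms I = {\<phi> \<in> extensional (carrier (polyring Quot I)).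
    (\<forall>f\<in>carrier (polyring Quot I). \<forall>g\<in>carrier (polyring Quot I).
      \<phi> (f \<oplus>\<^bsub>polyring Quot I\<^esub> g) = \<phi> f + \<phi> g) \<and>
    (\<forall>c. \<forall>f\<in>carrier (polyring Quot I).
      \<phi> (residue_class I (const_poly c) \<otimes>\<^bsub>polyring Quot I\<^esub> f) = c * \<phi> f)}"

text \<open>The fields \<open>mult\<close> and \<open>one\<close> of a module record carry no information.\<close>

definition canonical_module :: "('n::finite, 'k::field) mpoly set \<Rightarrow>
    (('n, 'k) mpoly set, ('n, 'k) mpoly set \<Rightarrow> 'k) module"
  where "canonical_module I =
    \<lparr>carrier = linear_forms I,
     monoid.mult = undefined, one = undefined,
     ring.zero = (\<lambda>g\<in>carrier (polyring Quot I). 0),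
     add = (\<lambda>\<phi> \<psi>. \<lambda>g\<in>carrier (polyring Quot I). \<phi> g + \<psi> g),
     module.smult = (\<lambda>f \<phi>. \<lambda>g\<in>carrier (polyring Quot I). \<phi> (f \<otimes>\<^bsub>polyring Quot I\<^esub> g))\<rparr>"

definition filtG :: "('n::finite, 'k::field) mpoly set \<Rightarrow> int \<Rightarrow> (('n, 'k) mpoly set \<Rightarrow> 'k) set"
  where "filtG I i = {\<phi> \<in> carrier (canonical_module I). \<forall>f\<in>filtR I (- i - 1). \<phi> f = 0}"

text \<open>
  Non-degeneracy of the multiplication pairing \<open>(f, \<phi>) \<mapsto> f \<cdot> \<phi>\<close> from \<open>R \<times> S\<close> to \<open>M\<close>, for a
  subset \<open>S\<close> of an \<open>R\<close>-module \<open>M\<close>.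
\<close>

definition nondegenerate_mult ::
    "('a, 'c) ring_scheme \<Rightarrow> ('a, 'b, 'd) module_scheme \<Rightarrow> 'b set \<Rightarrow> bool"
  where "nondegenerate_mult R M S \<longleftrightarrow>
    (\<forall>f\<in>carrier R. (\<forall>\<phi>\<in>S. f \<odot>\<^bsub>M\<^esub> \<phi> = \<zero>\<^bsub>M\<^esub>) \<longrightarrow> f = \<zero>\<^bsub>R\<^esub>) \<and>
    (\<forall>\<phi>\<in>S. (\<forall>f\<in>carrier R. f \<odot>\<^bsub>M\<^esub> \<phi> = \<zero>\<^bsub>M\<^esub>) \<longrightarrow> \<phi> = \<zero>\<^bsub>M\<^esub>)"

definition annihilator ::
    "('a, 'c) ring_scheme \<Rightarrow> ('a, 'b, 'd) module_scheme \<Rightarrow> 'b set \<Rightarrow> 'a set"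
  where "annihilator R M S = {f \<in> carrier R. \<forall>\<phi>\<in>S. f \<odot>\<^bsub>M\<^esub> \<phi> = \<zero>\<^bsub>M\<^esub>}"


section \<open>Consistency of the definitions\<close>

lemma polyring_cring: "cring (polyring :: ('n::finite, 'k::field) mpoly ring)"
  by (rule cring_from_type_algebra)

lemma quotient_cring:
  fixes I :: "('n::finite, 'k::field) mpoly set"
  assumes "ideal I polyring"
  shows "cring (polyring Quot I)"
  using ideal.quotient_is_cring[OF assms polyring_cring] .

lemma residue_class_ring_hom:
  fixes I :: "('n::finite, 'k::field) mpoly set"
  assumes "ideal I polyring"
  shows "residue_class I \<in> ring_hom polyring (polyring Quot I)"
  using ideal.rcos_ring_hom[OF assms] by (simp add: residue_class_def[abs_def])

lemma base_field_subfield: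
  fixes I :: "('n::finite, 'k::field) mpoly set"
  assumes "ideal I polyring" "I \<noteq> UNIV"
  shows "subfield (base_field I) (polyring Quot I)"
proof -
  let ?P = "polyring :: ('n, 'k) mpoly ring"
  let ?K = "ring_of_type_algebra :: 'k ring"
  interpret I: ideal I ?P by fact
  interpret R: cring "?P Quot I" by (rule quotient_cring) fact
  have "const_poly \<in> ring_hom ?K ?P"
    by (rule ring_hom_memI)
       (auto simp: ring_of_type_algebra_def const_poly_def mult_single single_add
          simp flip: single_one)
  then have h: "(\<lambda>c. residue_class I (const_poly c)) \<in> ring_hom ?K (?P Quot I)"
    using ring_hom_trans[OF _ residue_class_ring_hom[OF assms(1)]] by (simp add: comp_def)
  have K: "field ?K" by (rule field_from_type_algebra)
  interpret h: ring_hom_ring ?K "?P Quot I" "\<lambda>c. residue_class I (const_poly c)"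
    by (rule ring_hom_ringI2[OF _ R.ring_axioms h]) (rule ring_from_type_algebra)
  have "\<one>\<^bsub>?P Quot I\<^esub> \<noteq> \<zero>\<^bsub>?P Quot I\<^esub>"
  proof
    assume "\<one>\<^bsub>?P Quot I\<^esub> = \<zero>\<^bsub>?P Quot I\<^esub>"
    then have "I +>\<^bsub>?P\<^esub> \<one>\<^bsub>?P\<^esub> = I" by (simp add: FactRing_def)
    then have "\<one>\<^bsub>?P\<^esub> \<in> I" using I.a_rcos_self[of "\<one>\<^bsub>?P\<^esub>"] by auto
    then have "I = carrier ?P" by (rule I.one_imp_carrier)
    with assms(2) show False by (simp add: ring_of_type_algebra_def)
  qed
  moreover have "subfield (carrier ?K) ?K"
    using K by (simp add: field.carrier_is_subfield)
  ultimately have "subfield ((\<lambda>c. residue_class I (const_poly c)) ` carrier ?K) (?P Quot I)"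
    using ring_hom_ring.img_is_subfield(2)[OF h.ring_hom_ring_axioms] by blast
  then show ?thesis by (simp add: base_field_def ring_of_type_algebra_def)
qed

lemma canonical_module_module:
  fixes I :: "('n::finite, 'k::field) mpoly set"
  assumes "ideal I polyring"
  shows "module (polyring Quot I) (canonical_module I)"
proof -
  let ?P = "polyring :: ('n, 'k) mpoly ring"
  interpret R: cring "?P Quot I" by (rule quotient_cring) fact
  have rc: "residue_class I f \<in> carrier (?P Quot I)" for f
    using ring_hom_closed[OF residue_class_ring_hom[OF assms]]
    by (simp add: ring_of_type_algebra_def)
  show ?thesis
  proof (rule moduleI[OF R.cring_axioms])
    show "abelian_group (canonical_module I)"
    proof (rule abelian_groupI)
      fix \<phi> assume phi: "\<phi> \<in> carrier (canonical_module I)"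
      show "\<exists>\<psi>\<in>carrier (canonical_module I). \<psi> \<oplus>\<^bsub>canonical_module I\<^esub> \<phi> = \<zero>\<^bsub>canonical_module I\<^esub>"
        by (rule bexI[of _ "\<lambda>g\<in>carrier (?P Quot I). - \<phi> g"])
           (use phi rc in \<open>auto simp: canonical_module_def linear_forms_def fun_eq_iff\<close>)
    qed (use rc in \<open>auto simp: canonical_module_def linear_forms_def fun_eq_iff algebra_simps
            extensional_def\<close>)
    fix f \<phi> assume f: "f \<in> carrier (?P Quot I)" and phi: "\<phi> \<in> carrier (canonical_module I)"
    have "\<phi> (f \<otimes>\<^bsub>?P Quot I\<^esub> (residue_class I (const_poly c) \<otimes>\<^bsub>?P Quot I\<^esub> g)) = c * \<phi> (f \<otimes>\<^bsub>?P Quot I\<^esub> g)"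
      if g: "g \<in> carrier (?P Quot I)" for c g
      using phi f g rc
      by (subst R.m_lcomm) (auto simp: canonical_module_def linear_forms_def)
    then show "f \<odot>\<^bsub>canonical_module I\<^esub> \<phi> \<in> carrier (canonical_module I)"
      using f phi rc by (auto simp: canonical_module_def linear_forms_def R.r_distr)
  qed (use rc in \<open>auto simp: canonical_module_def linear_forms_def fun_eq_iff extensional_def
          R.l_distr R.m_lcomm R.m_assoc\<close>)
qed

end

theory Submission
  imports Defs
begin

text \<open>
  Let \<open>r = ri(R)\<close> and \<open>V = F\<^sub>r\<^sub>-\<^sub>1 R\<close>, a proper subspace of \<open>R\<close>. The elements of \<open>G\<^sub>-\<^sub>r \<omega>\<^sub>R\<close> are the linear
  forms vanishing on \<open>V\<close>, and linear forms separate points from subspaces, so \<open>f\<close> annihilates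
  \<open>G\<^sub>-\<^sub>r \<omega>\<^sub>R\<close> iff \<open>f R \<subseteq> V\<close>: condition (c) says that \<open>V\<close> contains no nonzero ideal of \<open>R\<close>. The second
  half of non-degeneracy is automatic because \<open>1 \<cdot> \<phi> = \<phi>\<close>.

  The Cayley-Bacharach property says that no minimal divisor is contained in \<open>V\<close>, and minimal
  divisors are nonzero ideals. Conversely, a nonzero ideal contained in \<open>V\<close> contains a minimal one,
  \<open>J/I\<close> with \<open>J = I + (f)\<close>. Then \<open>M = (I : f)\<close> is the radical of exactly one primary component \<open>Q\<close>,
  the other components contain \<open>J\<close>, and the modular law gives \<open>J = \<Inter>(\<Q> - {Q}) \<inter> (Q + (f))\<close>. As
  \<open>J/I \<cong> P/M\<close>, this is a minimal divisor.
\<close>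

section \<open>Ideals of a commutative ring carried by a type\<close>

lemma ring_of_type_algebra_sel [simp]:
  fixes a b :: "'a::comm_ring_1"
  shows "carrier (ring_of_type_algebra :: 'a ring) = UNIV"
    and "a \<oplus>\<^bsub>ring_of_type_algebra\<^esub> b = a + b"
    and "a \<otimes>\<^bsub>ring_of_type_algebra\<^esub> b = a * b"
    and "\<zero>\<^bsub>ring_of_type_algebra\<^esub> = (0::'a)"
    and "\<one>\<^bsub>ring_of_type_algebra\<^esub> = (1::'a)"
  by (simp_all add: ring_of_type_algebra_def)

lemma ring_of_type_algebra_pow [simp]:
  fixes a :: "'a::comm_ring_1"
  shows "a [^]\<^bsub>ring_of_type_algebra\<^esub> (n::nat) = a ^ n"
proof -
  interpret cring "ring_of_type_algebra :: 'a ring" by (rule cring_from_type_algebra)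
  show ?thesis by (induction n) (auto simp: mult.commute)
qed

lemma ring_of_type_algebra_a_inv [simp]:
  fixes a :: "'a::comm_ring_1"
  shows "\<ominus>\<^bsub>ring_of_type_algebra\<^esub> a = - a"
proof -
  interpret cring "ring_of_type_algebra :: 'a ring" by (rule cring_from_type_algebra)
  show ?thesis by (rule minus_equality) auto
qed

text \<open>Closure under negation is multiplication by -1, so it needs no clause of its own. This
  form replaces the locale predicate by closure conditions in type class arithmetic, on which
  automation works directly.\<close>

lemma ideal_ring_of_type_algebra_iff:
  fixes I :: "'a::comm_ring_1 set"
  shows "ideal I ring_of_type_algebra \<longleftrightarrow>
    0 \<in> I \<and> (\<forall>x\<in>I. \<forall>y\<in>I. x + y \<in> I) \<and> (\<forall>r. \<forall>x\<in>I. r * x \<in> I)" (is "_ \<longleftrightarrow> ?r")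
proof
  let ?R = "ring_of_type_algebra :: 'a ring"
  assume "ideal I ?R"
  then interpret ideal I ?R .
  show ?r
    using additive_subgroup.a_closed[OF is_additive_subgroup]
      additive_subgroup.zero_closed[OF is_additive_subgroup] I_l_closed by auto
next
  let ?R = "ring_of_type_algebra :: 'a ring"
  interpret cring ?R by (rule cring_from_type_algebra)
  assume r: ?r
  then have "- x \<in> I" if "x \<in> I" for x
    using that spec[of "\<lambda>r. \<forall>x\<in>I. r * x \<in> I" "-1"] by auto
  then have "subgroup I (add_monoid ?R)"
    using r by (intro add.subgroupI) (auto simp flip: a_inv_def)
  moreover have "x * a \<in> I" "a * x \<in> I" if "a \<in> I" for a x
    using r that by (simp_all add: mult.commute[of a x])
  ultimately show "ideal I ?R"
    by (intro idealI) (auto simp: ring_axioms)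
qed

context
  fixes I :: "'a::comm_ring_1 set"
  assumes I: "ideal I ring_of_type_algebra"
begin

lemma ideal_zero: "0 \<in> I"
  and ideal_add: "x \<in> I \<Longrightarrow> y \<in> I \<Longrightarrow> x + y \<in> I"
  and ideal_mult_left: "x \<in> I \<Longrightarrow> r * x \<in> I"
  and ideal_mult_right: "x \<in> I \<Longrightarrow> x * r \<in> I"
  using I by (auto simp: ideal_ring_of_type_algebra_iff mult.commute[of x r])

lemma ideal_diff: "x \<in> I \<Longrightarrow> y \<in> I \<Longrightarrow> x - y \<in> I"
  using ideal_add[of x "- y"] ideal_mult_left[of y "-1"] by simp

lemma ideal_eq_UNIV_iff: "I = UNIV \<longleftrightarrow> 1 \<in> I"
proof
  assume "1 \<in> I"
  then have "r \<in> I" for r using ideal_mult_left[of 1 r] by simp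
  then show "I = UNIV" by auto
qed simp

text \<open>The set is the ideal I + (f).\<close>

lemma ideal_adjoin: "ideal {a + h * f | a h. a \<in> I} ring_of_type_algebra"
  unfolding ideal_ring_of_type_algebra_iff
proof (intro conjI ballI allI)
  show "0 \<in> {a + h * f | a h. a \<in> I}"
    using ideal_zero by (auto intro!: exI[of _ 0] exI[of _ "0::'a"])
  fix x assume "x \<in> {a + h * f | a h. a \<in> I}"
  then obtain a h where x: "x = a + h * f" "a \<in> I" by auto
  show "r * x \<in> {a + h * f | a h. a \<in> I}" for r
  proof -
    have "r * x = r * a + (r * h) * f" "r * a \<in> I"
      using x(1) ideal_mult_left[OF x(2)] by (simp_all add: distrib_left mult.assoc)
    then show ?thesis by blast
  qed
  fix y assume "y \<in> {a + h * f | a h. a \<in> I}"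
  then obtain b k where y: "y = b + k * f" "b \<in> I" by auto
  have "x + y = (a + b) + (h + k) * f" using x y by (simp add: algebra_simps)
  then show "x + y \<in> {a + h * f | a h. a \<in> I}"
    using x y ideal_add by blast
qed

lemma subset_ideal_adjoin: "I \<subseteq> {a + h * f | a h. a \<in> I}"
proof
  fix x assume "x \<in> I"
  then have "x = x + 0 * f \<and> x \<in> I" by simp
  then show "x \<in> {a + h * f | a h. a \<in> I}" by blast
qed

lemma mem_ideal_adjoin: "f \<in> {a + h * f | a h. a \<in> I}"
proof -
  have "f = 0 + 1 * f \<and> 0 \<in> I" using ideal_zero by simp
  then show ?thesis by blast
qed

text \<open>The set is the colon ideal (I : f).\<close>

lemma ideal_colon: "ideal {h. h * f \<in> I} ring_of_type_algebra"
  by (auto simp: ideal_ring_of_type_algebra_iff distrib_right mult.assoc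
      intro: ideal_zero ideal_add ideal_mult_left)

end

lemma ideal_Inter:
  fixes F :: "'a::comm_ring_1 set set"
  assumes "\<And>J. J \<in> F \<Longrightarrow> ideal J ring_of_type_algebra"
  shows "ideal (\<Inter>F) ring_of_type_algebra"
  using assms by (auto simp: ideal_ring_of_type_algebra_iff)

lemma ideal_Int:
  fixes A B :: "'a::comm_ring_1 set"
  assumes "ideal A ring_of_type_algebra" "ideal B ring_of_type_algebra"
  shows "ideal (A \<inter> B) ring_of_type_algebra"
  using assms by (auto simp: ideal_ring_of_type_algebra_iff)

lemma ideal_sum:
  fixes Q :: "'a::comm_ring_1 set"
  assumes Q: "ideal Q ring_of_type_algebra" and "\<And>x. h x \<in> Q"
  shows "(\<Sum>x\<in>A. h x) \<in> Q"
  by (induction A rule: infinite_finite_induct) (auto intro: ideal_zero ideal_add Q assms(2))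

section \<open>Primary ideals\<close>

lemma mem_ideal_radical_iff:
  fixes f :: "'a::comm_ring_1"
  shows "f \<in> ideal_radical ring_of_type_algebra Q \<longleftrightarrow> (\<exists>m. f ^ m \<in> Q)"
  by (simp add: ideal_radical_def)

lemma primary_ideal_iff:
  fixes Q :: "'a::comm_ring_1 set"
  shows "primary_ideal ring_of_type_algebra Q \<longleftrightarrow>
    ideal Q ring_of_type_algebra \<and> 1 \<notin> Q \<and> (\<forall>f g. f * g \<in> Q \<longrightarrow> f \<in> Q \<or> (\<exists>m. g ^ m \<in> Q))"
  by (auto simp: primary_ideal_def mem_ideal_radical_iff simp flip: ideal_eq_UNIV_iff)

text \<open>For sums, the binomial theorem with exponent \<open>a + b\<close>: each term contains
  \<open>f\<close> at least \<open>a\<close> times or \<open>g\<close> at least \<open>b\<close>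
  times.\<close>

lemma ideal_ideal_radical:
  fixes Q :: "'a::comm_ring_1 set"
  assumes Q: "ideal Q ring_of_type_algebra"
  shows "ideal (ideal_radical ring_of_type_algebra Q) ring_of_type_algebra"
  unfolding ideal_ring_of_type_algebra_iff mem_ideal_radical_iff Ball_def
proof (intro conjI allI impI)
  show "\<exists>m. 0 ^ m \<in> Q" using ideal_zero[OF Q] by (intro exI[of _ 1]) simp
  fix f assume "\<exists>m. f ^ m \<in> Q"
  then obtain a where a: "f ^ a \<in> Q" ..
  show "\<exists>m. (r * f) ^ m \<in> Q" for r
    using ideal_mult_left[OF Q a] by (intro exI[of _ a]) (simp add: power_mult_distrib)
  fix g assume "\<exists>m. g ^ m \<in> Q"
  then obtain b where b: "g ^ b \<in> Q" ..
  have "of_nat ((a + b) choose k) * f ^ k * g ^ (a + b - k) \<in> Q" for k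
  proof (cases "a \<le> k")
    case True
    then have "f ^ k = f ^ (k - a) * f ^ a" by (simp flip: power_add)
    then have "f ^ k \<in> Q" using ideal_mult_left[OF Q a] by simp
    then show ?thesis by (intro ideal_mult_left[OF Q] ideal_mult_right[OF Q])
  next
    case False
    then have "g ^ (a + b - k) = g ^ (a - k) * g ^ b" by (simp flip: power_add)
    then have "g ^ (a + b - k) \<in> Q" using ideal_mult_left[OF Q b] by simp
    then show ?thesis by (rule ideal_mult_left[OF Q])
  qed
  then have "(f + g) ^ (a + b) \<in> Q"
    unfolding binomial_ring by (rule ideal_sum[OF Q])
  then show "\<exists>m. (f + g) ^ m \<in> Q" ..
qed

lemma ideal_radical_Int:
  fixes A B :: "'a::comm_ring_1 set"
  assumes A: "ideal A ring_of_type_algebra" and B: "ideal B ring_of_type_algebra"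
  shows "ideal_radical ring_of_type_algebra (A \<inter> B) =
    ideal_radical ring_of_type_algebra A \<inter> ideal_radical ring_of_type_algebra B"
proof -
  have "\<exists>m. f ^ m \<in> A \<inter> B" if "f ^ m \<in> A" "f ^ k \<in> B" for f m k
    using that ideal_mult_right[OF A] ideal_mult_left[OF B]
    by (auto simp: power_add intro!: exI[of _ "m + k"])
  then show ?thesis by (auto simp: mem_ideal_radical_iff)
qed

text \<open>The radicals of \<open>A\<close>, \<open>B\<close> and \<open>A \<inter> B\<close>
  agree. If \<open>f * g\<close> lies in the intersection and no power of \<open>g\<close> does,
  then no power of \<open>g\<close> lies in \<open>A\<close> or in \<open>B\<close>, so
  \<open>f\<close> lies in both.\<close>

lemma primary_ideal_Int:
  fixes A B :: "'a::comm_ring_1 set"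
  assumes A: "primary_ideal ring_of_type_algebra A" and B: "primary_ideal ring_of_type_algebra B"
    and eq: "ideal_radical ring_of_type_algebra A = ideal_radical ring_of_type_algebra B"
  shows "primary_ideal ring_of_type_algebra (A \<inter> B)"
proof -
  have iA: "ideal A ring_of_type_algebra" and iB: "ideal B ring_of_type_algebra"
    using A B by (auto simp: primary_ideal_iff)
  have rA: "(\<exists>m. g ^ m \<in> A \<inter> B) \<longleftrightarrow> (\<exists>m. g ^ m \<in> A)"
    and rB: "(\<exists>m. g ^ m \<in> A) \<longleftrightarrow> (\<exists>m. g ^ m \<in> B)" for g
    using ideal_radical_Int[OF iA iB] eq unfolding mem_ideal_radical_iff[symmetric] by auto
  show ?thesis
    using A B unfolding primary_ideal_iff rA
    using rB ideal_Int[OF iA iB] by blast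
qed

lemma ex_primary_decomposition:
  fixes I :: "('n::finite, 'k::field) mpoly set"
  assumes F: "finite F" "\<And>Q. Q \<in> F \<Longrightarrow> primary_ideal polyring Q" "\<Inter>F = I"
  shows "\<exists>\<Q>. primary_decomposition I \<Q>"
proof -
  define G where "G F \<longleftrightarrow> finite F \<and> (\<forall>Q\<in>F. primary_ideal polyring Q) \<and> \<Inter>F = I"
    for F :: "('n, 'k) mpoly set set"
  \<comment> \<open>A family with the least number of members is irredundant, and its radicals are distinct
    because two members with the same radical could be replaced by their intersection.\<close>
  obtain \<Q> where Q: "G \<Q>" and min: "\<And>F. G F \<Longrightarrow> card \<Q> \<le> card F"
  proof -
    have "G F" using F by (simp add: G_def)
    then show ?thesis using ex_has_least_nat[of G F card] that by blast
  qed
  have irred: "\<Inter>(\<Q> - {Q}) \<noteq> I" if "Q \<in> \<Q>" for Q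
  proof
    assume "\<Inter>(\<Q> - {Q}) = I"
    then have "G (\<Q> - {Q})" using Q by (auto simp: G_def)
    then have "card \<Q> \<le> card (\<Q> - {Q})" by (rule min)
    also have "\<dots> < card \<Q>"
      using Q that by (intro card_Diff1_less) (auto simp: G_def)
    finally show False by simp
  qed
  moreover have "inj_on (ideal_radical polyring) \<Q>"
  proof (rule inj_onI, rule ccontr)
    fix A B assume AB: "A \<in> \<Q>" "B \<in> \<Q>" "ideal_radical polyring A = ideal_radical polyring B" "A \<noteq> B"
    define F where "F = insert (A \<inter> B) (\<Q> - {A} - {B})"
    have "primary_ideal polyring (A \<inter> B)"
      using AB Q by (intro primary_ideal_Int) (auto simp: G_def)
    moreover have "\<Inter>F = \<Inter>\<Q>"
      using AB by (auto simp: F_def)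
    ultimately have "G F"
      using Q by (auto simp: G_def F_def)
    moreover have "card F < card \<Q>"
    proof -
      \<comment> \<open>Only an inequality, since \<open>A \<inter> B\<close> may already be one of
        the remaining members.\<close>
      have "card F \<le> Suc (card (\<Q> - {A} - {B}))"
        using Q by (simp add: F_def G_def card_insert_if)
      also have "\<dots> \<le> card (\<Q> - {A})"
        using AB Q by (intro Suc_leI card_Diff1_less) (auto simp: G_def)
      also have "\<dots> < card \<Q>"
        using AB Q by (intro card_Diff1_less) (auto simp: G_def)
      finally show ?thesis .
    qed
    ultimately show False using min[of F] by simp
  qed
  ultimately show ?thesis
    using Q unfolding primary_decomposition_def G_def by blast
qed

section \<open>Subspaces of residue class rings\<close>

lemma residue_class_eq:
  "residue_class I f = (\<lambda>a. a + f) ` I"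
  by (auto simp: residue_class_def a_r_coset_def r_coset_def)

lemma const_poly_simps:
  "const_poly 0 = 0" "const_poly 1 = 1" "const_poly (a + b) = const_poly a + const_poly b"
  "const_poly (a * b) = const_poly a * const_poly b"
  by (auto simp: const_poly_def mult_single single_add simp flip: single_one)

text \<open>Bases and linear forms are handled in P, where the vectors fill a whole type. Subspaces
  of R then appear as images of subspaces of P under \<open>residue_class I\<close>.\<close>

interpretation mpoly: vector_space "\<lambda>c (f :: ('n::finite, 'k::field) mpoly). const_poly c * f"
  by unfold_locales (auto simp: const_poly_simps algebra_simps)

interpretation mpoly_form: vector_space_pair
  "\<lambda>c (f :: ('n::finite, 'k::field) mpoly). const_poly c * f" "(*) :: 'k \<Rightarrow> 'k \<Rightarrow> 'k"
  by unfold_locales (auto simp: algebra_simps)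

lemma ideal_imp_subspace: "ideal I polyring \<Longrightarrow> mpoly.subspace I"
  by (auto simp: mpoly.subspace_def ideal_ring_of_type_algebra_iff)

text \<open>As \<open>f\<close> is not in the span of a basis of \<open>V\<close>, adding it keeps
  the basis independent, and the values 1 at \<open>f\<close> and 0 on the basis extend to a linear
  form.\<close>

lemma ex_separating_form:
  fixes V :: "('n::finite, 'k::field) mpoly set"
  assumes V: "mpoly.subspace V" and f: "f \<notin> V"
  obtains \<phi> where "Vector_Spaces.linear (\<lambda>c (f :: ('n, 'k) mpoly). const_poly c * f) (*) \<phi>"
    "\<And>v. v \<in> V \<Longrightarrow> \<phi> v = 0" "\<phi> f = 1"
proof -
  obtain B where B: "B \<subseteq> V" "mpoly.independent B" "V \<subseteq> mpoly.span B"
    using mpoly.maximal_independent_subset[of V] by blast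
  have span: "mpoly.span B = V"
    using B V by (simp add: mpoly.span_minimal subset_antisym)
  then have "mpoly.independent (insert f B)"
    using B f by (simp add: mpoly.independent_insert)
  from mpoly_form.linear_independent_extend[OF this, of "\<lambda>b. if b = f then 1 else 0"]
  obtain \<phi> where lin: "Vector_Spaces.linear (\<lambda>c (f :: ('n, 'k) mpoly). const_poly c * f) (*) \<phi>"
    and \<phi>: "\<And>b. b \<in> insert f B \<Longrightarrow> \<phi> b = (if b = f then 1 else 0)"
    by blast
  have "\<phi> v = 0" if "v \<in> V" for v
  proof (rule mpoly_form.linear_eq_0_on_span[OF lin])
    show "v \<in> mpoly.span B" using that span by simp
    show "\<phi> b = 0" if "b \<in> B" for b using \<phi>[of b] that B f by auto
  qed
  with lin \<phi>[of f] show ?thesis by (intro that[of \<phi>]) auto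
qed

context
  fixes I :: "('n::finite, 'k::field) mpoly set"
  assumes I: "ideal I polyring"
begin

lemma residue_class_eq_iff: "residue_class I f = residue_class I g \<longleftrightarrow> f - g \<in> I"
proof
  assume "residue_class I f = residue_class I g"
  moreover have "f \<in> residue_class I f"
    using ideal_zero[OF I] by (force simp: residue_class_eq)
  ultimately show "f - g \<in> I" by (auto simp: residue_class_eq)
next
  have *: "residue_class I f \<subseteq> residue_class I g" if "f - g \<in> I" for f g
  proof
    fix x assume "x \<in> residue_class I f"
    then obtain a where a: "a \<in> I" "x = a + f" by (auto simp: residue_class_eq)
    then have "x = (a + (f - g)) + g" "a + (f - g) \<in> I"
      using ideal_add[OF I] that by auto
    then show "x \<in> residue_class I g" unfolding residue_class_eq by blast
  qed
  assume fg: "f - g \<in> I"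
  then have "g - f \<in> I" using ideal_diff[OF I ideal_zero[OF I] fg] by simp
  with fg * show "residue_class I f = residue_class I g" by blast
qed

lemma residue_class_eq_zero_iff: "residue_class I f = residue_class I 0 \<longleftrightarrow> f \<in> I"
  by (simp add: residue_class_eq_iff)

lemma carrier_quotient: "carrier (polyring Quot I) = range (residue_class I)"
  by (auto simp: FactRing_def A_RCOSETS_def RCOSETS_def residue_class_def a_r_coset_def)

lemma residue_class_closed: "residue_class I f \<in> carrier (polyring Quot I)"
  by (simp add: carrier_quotient)

lemma residue_class_add:
    "residue_class I f \<oplus>\<^bsub>polyring Quot I\<^esub> residue_class I g = residue_class I (f + g)"
  and residue_class_mult:
    "residue_class I f \<otimes>\<^bsub>polyring Quot I\<^esub> residue_class I g = residue_class I (f * g)"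
  using residue_class_ring_hom[OF I] by (simp_all add: ring_hom_def)

lemma residue_class_zero: "\<zero>\<^bsub>polyring Quot I\<^esub> = residue_class I 0"
  by (simp add: FactRing_def residue_class_eq)

lemma residue_class_image_mem_iff:
  assumes "mpoly.subspace V" "I \<subseteq> V"
  shows "residue_class I f \<in> residue_class I ` V \<longleftrightarrow> f \<in> V"
proof
  assume "residue_class I f \<in> residue_class I ` V"
  then obtain v where "v \<in> V" "f - v \<in> I" by (auto simp: residue_class_eq_iff)
  then have "(f - v) + v \<in> V" using assms by (blast intro: mpoly.subspace_add)
  then show "f \<in> V" by simp
qed auto

text \<open>The preimage is I + V, a sum of two subspaces.\<close>

lemma subspace_vimage_residue_class:
  assumes "mpoly.subspace V"
  shows "mpoly.subspace {f. residue_class I f \<in> residue_class I ` V}"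
proof -
  have eq: "{f. residue_class I f \<in> residue_class I ` V} = {a + v | a v. a \<in> I \<and> v \<in> V}"
  proof safe
    fix f v assume "residue_class I f = residue_class I v" "v \<in> V"
    then have "f = (f - v) + v \<and> f - v \<in> I \<and> v \<in> V" by (simp add: residue_class_eq_iff)
    then show "\<exists>a v. f = a + v \<and> a \<in> I \<and> v \<in> V" by blast
  next
    fix a v assume "a \<in> I" "v \<in> V"
    then have "residue_class I (a + v) = residue_class I v" by (simp add: residue_class_eq_iff)
    with \<open>v \<in> V\<close> show "residue_class I (a + v) \<in> residue_class I ` V" by blast
  qed
  show ?thesis unfolding eq
    by (rule mpoly.subspace_sums) (auto intro: ideal_imp_subspace I assms)
qed

context
  assumes proper: "I \<noteq> UNIV"
begin

interpretation R: cring "polyring Quot I"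
  by (rule quotient_cring[OF I])

lemmas K_subfield = base_field_subfield[OF I proper]

text \<open>Despite its name, \<open>subalgebra\<close> only asks for an additive subgroup closed
  under scalars, that is, a K-subspace.\<close>

lemma subalgebra_residue_class_image:
  assumes V: "mpoly.subspace V"
  shows "subalgebra (base_field I) (residue_class I ` V) (polyring Quot I)"
proof -
  have "subgroup (residue_class I ` V) (add_monoid (polyring Quot I))"
  proof (rule R.add.subgroupI)
    show "residue_class I ` V \<subseteq> carrier (polyring Quot I)"
      by (auto simp: residue_class_closed)
    show "residue_class I ` V \<noteq> {}" using mpoly.subspace_0[OF V] by auto
    fix a assume "a \<in> residue_class I ` V"
    then obtain v where v: "a = residue_class I v" "v \<in> V" by auto
    have "\<ominus>\<^bsub>polyring Quot I\<^esub> a = residue_class I (- v)"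
      by (rule R.minus_equality)
        (auto simp: v residue_class_closed residue_class_add residue_class_zero)
    then show "\<ominus>\<^bsub>polyring Quot I\<^esub> a \<in> residue_class I ` V"
      using mpoly.subspace_neg[OF V] v by auto
    fix b assume "b \<in> residue_class I ` V"
    then obtain w where "b = residue_class I w" "w \<in> V" by auto
    with v show "a \<oplus>\<^bsub>polyring Quot I\<^esub> b \<in> residue_class I ` V"
      by (simp add: residue_class_add mpoly.subspace_add[OF V])
  qed
  then show ?thesis
    using mpoly.subspace_scale[OF V]
    by (auto simp: subalgebra_def subalgebra_axioms_def base_field_def residue_class_mult)
qed

context
  assumes fin: "zero_dimensional I"
begin

lemma finite_dimension_residue_class_image:
  assumes "mpoly.subspace V"
  shows "R.finite_dimension (base_field I) (residue_class I ` V)"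
  using R.subalbegra_incl_imp_finite_dimension[OF K_subfield]
    fin subalgebra_residue_class_image[OF assms] R.subalgebra_in_carrier
  unfolding zero_dimensional_def by blast

lemma dimension_residue_class_image:
  assumes "mpoly.subspace V"
  shows "R.dimension (dimK I (residue_class I ` V)) (base_field I) (residue_class I ` V)"
  using R.finite_dimensionE[OF K_subfield finite_dimension_residue_class_image[OF assms]]
  by (simp add: dimK_def over_def)

text \<open>A basis of the smaller space is an independent list in the larger one; if its length
  equals the larger dimension, it spans that space too.\<close>

lemma dimK_residue_class_image_mono:
  assumes V: "mpoly.subspace V" and W: "mpoly.subspace W"
    and sub: "residue_class I ` V \<subseteq> residue_class I ` W"
  shows "dimK I (residue_class I ` V) \<le> dimK I (residue_class I ` W)"
    and "dimK I (residue_class I ` V) = dimK I (residue_class I ` W) \<Longrightarrow>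
      residue_class I ` V = residue_class I ` W"
proof -
  obtain Us where Us: "R.independent (base_field I) Us"
      "length Us = dimK I (residue_class I ` V)" "R.Span (base_field I) Us = residue_class I ` V"
    using R.exists_base[OF K_subfield dimension_residue_class_image[OF V]] by blast
  then have Us': "set Us \<subseteq> residue_class I ` W"
    using R.Span_base_incl[OF K_subfield R.independent_in_carrier[OF Us(1)]] sub by (simp only: Us(3))
  show "dimK I (residue_class I ` V) \<le> dimK I (residue_class I ` W)"
    using R.independent_length_le_dimension[OF K_subfield dimension_residue_class_image[OF W] Us(1) Us']
      Us(2) by simp
  show "residue_class I ` V = residue_class I ` W"
    if "dimK I (residue_class I ` V) = dimK I (residue_class I ` W)"
    using R.independent_length_eq_dimension[OF K_subfield dimension_residue_class_image[OF W] Us(1) Us']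
      Us(2,3) that by simp
qed

text \<open>A vector of \<open>W\<close> outside \<open>V\<close> stays outside modulo
  \<open>I\<close>, because \<open>V\<close> contains \<open>I\<close>. This strict growth drives
  the induction and minimality arguments for ideals above \<open>I\<close>.\<close>

lemma dimK_residue_class_image_strict_mono:
  assumes V: "mpoly.subspace V" and W: "mpoly.subspace W" and I_sub: "I \<subseteq> V" and sub: "V \<subset> W"
  shows "dimK I (residue_class I ` V) < dimK I (residue_class I ` W)"
proof -
  obtain w where w: "w \<in> W" "w \<notin> V" using sub by blast
  have "residue_class I w \<notin> residue_class I ` V"
    using residue_class_image_mem_iff[OF V I_sub] w by simp
  then have "residue_class I ` V \<noteq> residue_class I ` W" using w by blast
  moreover have "residue_class I ` V \<subseteq> residue_class I ` W" using sub by blast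
  ultimately show ?thesis
    using dimK_residue_class_image_mono[OF V W] by (meson order_less_le)
qed

end
end
end

section \<open>Dimensions under multiplication by a polynomial\<close>

text \<open>\<open>line_extension K u E\<close> is the sum K u + E. The lemma serves the case in
  which the image of a new basis vector is already in the span of the earlier images.\<close>

lemma (in ring) line_extension_absorb:
  assumes K: "subfield K R" and E: "dimension n K E" and u: "u \<in> E"
  shows "line_extension K u E = E"
proof
  note props = space_subgroup_props[OF K E]
  show "line_extension K u E \<subseteq> E"
    using props(3,5) u by (auto simp: line_extension_mem_iff)
  show "E \<subseteq> line_extension K u E"
  proof
    fix v assume v: "v \<in> E"
    have "v = \<zero> \<otimes> u \<oplus> v" using props(1) u v by (simp add: subset_iff)
    moreover have "\<zero> \<in> K" using subring_props(2)[OF K] .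
    ultimately show "v \<in> line_extension K u E" using v by (auto simp: line_extension_mem_iff)
  qed
qed

text \<open>
  The dimension of the image of a subspace \<open>S\<close> of \<open>P/A\<close> under the map \<open>P/A \<rightarrow> P/B\<close> induced by
  multiplication with \<open>f\<close>, which exists if \<open>A f \<subseteq> B\<close> and is injective if \<open>A = (B : f)\<close>.
\<close>

lemma dimension_mult_image:
  fixes A B :: "('n::finite, 'k::field) mpoly set"
  assumes A: "ideal A polyring" "A \<noteq> UNIV" and B: "ideal B polyring" "B \<noteq> UNIV"
    and AB: "\<And>h. h \<in> A \<Longrightarrow> h * f \<in> B"
    and dim: "ring.dimension (polyring Quot A) n (base_field A) S"
  shows "\<exists>m\<le>n. ring.dimension (polyring Quot B) m (base_field B)
      {residue_class B (h * f) | h. residue_class A h \<in> S} \<and>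
    ((\<forall>h. h * f \<in> B \<longrightarrow> h \<in> A) \<longrightarrow> m = n)"
proof -
  interpret RA: cring "polyring Quot A" by (rule quotient_cring[OF A(1)])
  interpret RB: cring "polyring Quot B" by (rule quotient_cring[OF B(1)])
  define T where "T S = {residue_class B (h * f) | h. residue_class A h \<in> S}" for S
  have "\<exists>m\<le>n. RB.dimension m (base_field B) (T S) \<and> ((\<forall>h. h * f \<in> B \<longrightarrow> h \<in> A) \<longrightarrow> m = n)"
    using dim
  proof (induction n "base_field A" S rule: RA.dimension.induct)
    case zero_dim
    have "residue_class B (h * f) = residue_class B 0" if "h \<in> A" for h
      using AB[OF that] by (simp add: residue_class_eq_zero_iff[OF B(1)])
    moreover have "residue_class B 0 \<in> T {residue_class A 0}"
      unfolding T_def by (auto intro: exI[of _ 0])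
    ultimately have "T {\<zero>\<^bsub>polyring Quot A\<^esub>} = {\<zero>\<^bsub>polyring Quot B\<^esub>}"
      by (auto simp: T_def residue_class_zero[OF A(1)] residue_class_zero[OF B(1)]
          residue_class_eq_zero_iff[OF A(1)])
    then show ?case by auto
  next
    case (Suc_dim v S n)
    obtain g where g: "v = residue_class A g"
      using Suc_dim.hyps(1) by (auto simp: carrier_quotient[OF A(1)])
    have S_carrier: "S \<subseteq> carrier (polyring Quot A)"
      using RA.space_subgroup_props(1)[OF base_field_subfield[OF A] Suc_dim.hyps(3)] .
    \<comment> \<open>Adjoining the class of \<open>g\<close> to \<open>S\<close> adjoins the class
      of \<open>g * f\<close> to the image, so the induction follows a basis vector by
      vector.\<close>
    have line: "T (RA.line_extension (base_field A) v S) =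
      RB.line_extension (base_field B) (residue_class B (g * f)) (T S)"
    proof safe
      fix y assume "y \<in> T (RA.line_extension (base_field A) v S)"
      then obtain h where h: "y = residue_class B (h * f)"
          "residue_class A h \<in> RA.line_extension (base_field A) v S"
        by (auto simp: T_def)
      then obtain c x where x: "x \<in> S" and
          eq: "residue_class A h = residue_class A (const_poly c) \<otimes>\<^bsub>polyring Quot A\<^esub> v \<oplus>\<^bsub>polyring Quot A\<^esub> x"
        by (auto simp: RA.line_extension_mem_iff base_field_def)
      obtain k where k: "x = residue_class A k"
        using x S_carrier by (auto simp: carrier_quotient[OF A(1)])
      have "h - (const_poly c * g + k) \<in> A"
        using eq by (simp add: g k residue_class_add[OF A(1)] residue_class_mult[OF A(1)]
            residue_class_eq_iff[OF A(1)])
      from AB[OF this] have "h * f - (const_poly c * (g * f) + k * f) \<in> B"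
        by (simp add: algebra_simps)
      then have "y = residue_class B (const_poly c) \<otimes>\<^bsub>polyring Quot B\<^esub> residue_class B (g * f)
          \<oplus>\<^bsub>polyring Quot B\<^esub> residue_class B (k * f)"
        by (simp add: h residue_class_add[OF B(1)] residue_class_mult[OF B(1)]
            residue_class_eq_iff[OF B(1)])
      moreover have "residue_class B (k * f) \<in> T S" using x k by (auto simp: T_def)
      ultimately show "y \<in> RB.line_extension (base_field B) (residue_class B (g * f)) (T S)"
        by (auto simp: RB.line_extension_mem_iff base_field_def)
    next
      fix y assume "y \<in> RB.line_extension (base_field B) (residue_class B (g * f)) (T S)"
      then obtain c k where k: "residue_class A k \<in> S" and
          eq: "y = residue_class B (const_poly c) \<otimes>\<^bsub>polyring Quot B\<^esub> residue_class B (g * f)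
            \<oplus>\<^bsub>polyring Quot B\<^esub> residue_class B (k * f)"
        by (auto simp: RB.line_extension_mem_iff base_field_def T_def)
      have "y = residue_class B ((const_poly c * g + k) * f)"
        by (simp add: eq residue_class_add[OF B(1)] residue_class_mult[OF B(1)] algebra_simps)
      moreover have "residue_class A (const_poly c * g + k) =
          residue_class A (const_poly c) \<otimes>\<^bsub>polyring Quot A\<^esub> v \<oplus>\<^bsub>polyring Quot A\<^esub> residue_class A k"
        by (simp add: g residue_class_add[OF A(1)] residue_class_mult[OF A(1)])
      then have "residue_class A (const_poly c * g + k) \<in> RA.line_extension (base_field A) v S"
        using k by (auto simp: RA.line_extension_mem_iff base_field_def)
      ultimately show "y \<in> T (RA.line_extension (base_field A) v S)"
        by (auto simp: T_def)
    qed
    from Suc_dim.hyps(4) obtain m where m: "m \<le> n" "RB.dimension m (base_field B) (T S)"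
        "(\<forall>h. h * f \<in> B \<longrightarrow> h \<in> A) \<longrightarrow> m = n"
      by blast
    show ?case
    proof (cases "residue_class B (g * f) \<in> T S")
      \<comment> \<open>The dimension of the image does not grow. Here \<open>g - k\<close> is
        multiplied into \<open>B\<close> without lying in \<open>A\<close>, so the map is not
        injective and the claim about equality is vacuous.\<close>
      case True
      then obtain k where k: "residue_class A k \<in> S" "(g - k) * f \<in> B"
        by (auto simp: T_def residue_class_eq_iff[OF B(1)] left_diff_distrib)
      have "residue_class A g \<noteq> residue_class A k"
        using k(1) Suc_dim.hyps(2) g by auto
      then have "g - k \<notin> A" by (simp add: residue_class_eq_iff[OF A(1)])
      then have "\<not> (\<forall>h. h * f \<in> B \<longrightarrow> h \<in> A)" using k(2) by blast
      moreover have "RB.dimension m (base_field B) (T (RA.line_extension (base_field A) v S))"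
        using RB.line_extension_absorb[OF base_field_subfield[OF B] m(2) True] m(2) line by simp
      ultimately show ?thesis using m(1) by (intro exI[of _ m]) auto
    next
      case False
      then have "RB.dimension (Suc m) (base_field B) (T (RA.line_extension (base_field A) v S))"
        unfolding line using m(2) by (intro RB.Suc_dim) (auto simp: residue_class_closed[OF B(1)])
      then show ?thesis using m by (intro exI[of _ "Suc m"]) auto
    qed
  qed
  then show ?thesis by (simp add: T_def)
qed

text \<open>Multiplication by 1 induces the projection from P/A onto P/B, and the image of a
  finite-dimensional space is finite-dimensional.\<close>

lemma zero_dimensional_superset:
  fixes A B :: "('n::finite, 'k::field) mpoly set"
  assumes A: "ideal A polyring" and B: "ideal B polyring" "B \<noteq> UNIV"
    and "A \<subseteq> B" and "zero_dimensional A"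
  shows "zero_dimensional B"
proof -
  have A': "A \<noteq> UNIV" using assms by auto
  interpret RA: cring "polyring Quot A" by (rule quotient_cring[OF A])
  interpret RB: cring "polyring Quot B" by (rule quotient_cring[OF B(1)])
  obtain n where "RA.dimension n (base_field A) (carrier (polyring Quot A))"
    using assms(5) by (auto simp: zero_dimensional_def)
  from dimension_mult_image[OF A A' B _ this, of 1] assms(4)
  obtain m where "RB.dimension m (base_field B)
      {residue_class B (h * 1) | h. residue_class A h \<in> carrier (polyring Quot A)}"
    by auto
  moreover have "{residue_class B (h * 1) | h. residue_class A h \<in> carrier (polyring Quot A)} =
      carrier (polyring Quot B)"
    by (auto simp: carrier_quotient[OF A] carrier_quotient[OF B(1)])
  ultimately show ?thesis
    by (auto simp: zero_dimensional_def RB.finite_dimension_def)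
qed

text \<open>With M = (I : f), multiplication by \<open>f\<close> induces an isomorphism from P/M
  onto (I + (f))/I.\<close>

lemma dimK_principal:
  fixes I :: "('n::finite, 'k::field) mpoly set"
  assumes I: "ideal I polyring" "I \<noteq> UNIV" "zero_dimensional I" and f: "f \<notin> I"
    and M: "M = {h. h * f \<in> I}"
  shows "dimK I (residue_class I ` {a + h * f | a h. a \<in> I}) = dimK M (carrier (polyring Quot M))"
proof -
  have iM: "ideal M polyring" unfolding M by (rule ideal_colon[OF I(1)])
  have M': "M \<noteq> UNIV" using f ideal_eq_UNIV_iff[OF iM] by (auto simp: M)
  have sub: "I \<subseteq> M" using ideal_mult_right[OF I(1)] by (auto simp: M)
  interpret RM: cring "polyring Quot M" by (rule quotient_cring[OF iM])
  interpret RI: cring "polyring Quot I" by (rule quotient_cring[OF I(1)])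
  have "RM.finite_dimension (base_field M) (carrier (polyring Quot M))"
    using zero_dimensional_superset[OF I(1) iM M' sub I(3)] by (simp add: zero_dimensional_def)
  then have dim: "RM.dimension (dimK M (carrier (polyring Quot M))) (base_field M) (carrier (polyring Quot M))"
    using RM.finite_dimensionE[OF base_field_subfield[OF iM M']] by (simp add: dimK_def over_def)
  have "{residue_class I (h * f) | h. residue_class M h \<in> carrier (polyring Quot M)} =
      residue_class I ` {a + h * f | a h. a \<in> I}"
  proof safe
    show "residue_class I (h * f) \<in> residue_class I ` {a + h * f | a h. a \<in> I}" for h
    proof (rule imageI)
      have "h * f = 0 + h * f \<and> 0 \<in> I" using ideal_zero[OF I(1)] by simp
      then show "h * f \<in> {a + h * f | a h. a \<in> I}" by blast
    qed
    fix a h assume "a \<in> I"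
    then have "residue_class I (a + h * f) = residue_class I (h * f)"
      by (simp add: residue_class_eq_iff[OF I(1)])
    then show "\<exists>h'. residue_class I (a + h * f) = residue_class I (h' * f) \<and>
        residue_class M h' \<in> carrier (polyring Quot M)"
      using residue_class_closed[OF iM] by blast
  qed
  with dimension_mult_image[OF iM M' I(1,2) _ dim, of f]
  have "RI.dimension (dimK M (carrier (polyring Quot M))) (base_field I)
      (residue_class I ` {a + h * f | a h. a \<in> I})"
    by (auto simp: M)
  then show ?thesis
    using RI.dimI[OF base_field_subfield[OF I(1,2)]] by (simp add: dimK_def over_def)
qed

section \<open>Existence of a primary decomposition\<close>

text \<open>All dimensions are bounded by that of R. This replaces a chain condition, both for colon
  ideals and for the degree filtration.\<close>

lemma ex_max_dimK:
  fixes I :: "('n::finite, 'k::field) mpoly set"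
  assumes I: "ideal I polyring" "I \<noteq> UNIV" "zero_dimensional I"
    and V: "\<And>k. k \<ge> (m::nat) \<Longrightarrow> mpoly.subspace (V k)"
  shows "\<exists>k\<ge>m. \<forall>j\<ge>m. dimK I (residue_class I ` V j) \<le> dimK I (residue_class I ` V k)"
proof -
  have "dimK I (residue_class I ` V k) \<le> dimK I (residue_class I ` UNIV)" if "k \<ge> m" for k
    using dimK_residue_class_image_mono(1)[OF I V[OF that] mpoly.subspace_UNIV] by blast
  then have bound: "\<forall>k\<ge>m. dimK I (residue_class I ` V k) < Suc (dimK I (residue_class I ` UNIV))"
    by (simp add: less_Suc_eq_le)
  from ex_has_greatest_nat[of "\<lambda>k. m \<le> k", OF order.refl bound] show ?thesis .
qed

text \<open>Noetherian induction, measured by the codimension of A/I in R: it drops at every proper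
  superideal of \<open>A\<close>.\<close>

lemma ex_finite_primary_family:
  fixes I :: "('n::finite, 'k::field) mpoly set"
  assumes I: "ideal I polyring" "I \<noteq> UNIV" "zero_dimensional I"
    and A: "ideal A polyring" "I \<subseteq> A"
  shows "\<exists>F. finite F \<and> (\<forall>Q\<in>F. primary_ideal polyring Q) \<and> \<Inter>F = A"
  using A
proof (induction "dimK I (residue_class I ` UNIV) - dimK I (residue_class I ` A)"
    arbitrary: A rule: less_induct)
  case (less A)
  note A = less.prems
  let ?d = "\<lambda>A. dimK I (residue_class I ` A)"
  have IH: "\<exists>F. finite F \<and> (\<forall>Q\<in>F. primary_ideal polyring Q) \<and> \<Inter>F = B"
    if B: "ideal B polyring" "A \<subset> B" for B
  proof (rule less.hyps)
    have "?d A < ?d B"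
      using B A by (intro dimK_residue_class_image_strict_mono[OF I]) (auto intro: ideal_imp_subspace)
    moreover have "?d B \<le> ?d UNIV"
      using B by (intro dimK_residue_class_image_mono(1)[OF I])
        (auto intro: ideal_imp_subspace mpoly.subspace_UNIV)
    ultimately show "?d UNIV - ?d B < ?d UNIV - ?d A" by linarith
    show "ideal B polyring" "I \<subseteq> B" using B A by auto
  qed
  consider "A = UNIV" | "primary_ideal polyring A" | "A \<noteq> UNIV" "\<not> primary_ideal polyring A" by blast
  then show ?case
  proof cases
    case 1
    then show ?thesis by (intro exI[of _ "{}"]) auto
  next
    case 2
    then show ?thesis by (intro exI[of _ "{A}"]) auto
  next
    case 3
    \<comment> \<open>The chain of the \<open>(A : g\<^sup>k)\<close> becomes stationary; once \<open>(A : g\<^sup>2\<^sup>k) = (A : g\<^sup>k)\<close>, the ideal \<open>A\<close>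
      is the intersection of its proper superideals \<open>(A : g\<^sup>k)\<close> and \<open>A + (g\<^sup>k)\<close>.\<close>
    then obtain f g where fg: "f * g \<in> A" "f \<notin> A" "\<And>m. g ^ m \<notin> A"
      using A(1) ideal_eq_UNIV_iff[OF A(1)] by (auto simp: primary_ideal_iff)
    define C where "C k = {h. h * g ^ k \<in> A}" for k
    have C: "ideal (C k) polyring" "A \<subseteq> C k" for k
      unfolding C_def using ideal_colon[OF A(1)] ideal_mult_right[OF A(1)] by auto
    have C_mono: "C j \<subseteq> C k" if "j \<le> k" for j k
    proof
      fix h assume "h \<in> C j"
      then have "h * g ^ j * g ^ (k - j) \<in> A" by (simp add: C_def ideal_mult_right[OF A(1)])
      then show "h \<in> C k" using that by (simp add: C_def mult.assoc flip: power_add)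
    qed
    \<comment> \<open>The chain starts at 1 because \<open>C 0\<close> is just \<open>A\<close>,
      whereas \<open>C 1\<close> contains \<open>f\<close> and so makes \<open>C k\<close> strictly
      larger than \<open>A\<close>.\<close>
    obtain k where k: "k \<ge> 1" "\<And>j. j \<ge> 1 \<Longrightarrow> ?d (C j) \<le> ?d (C k)"
      using ex_max_dimK[OF I, of 1 C] ideal_imp_subspace[OF C(1)] by blast
    have stable: "C (2 * k) = C k"
    proof (rule ccontr)
      assume "C (2 * k) \<noteq> C k"
      then have "C k \<subset> C (2 * k)" using C_mono[of k "2 * k"] by auto
      then have "?d (C k) < ?d (C (2 * k))"
        using A C by (intro dimK_residue_class_image_strict_mono[OF I]) (auto intro: ideal_imp_subspace)
      then show False using k(2)[of "2 * k"] k(1) by simp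
    qed
    define B where "B = {a + h * g ^ k | a h. a \<in> A}"
    have B: "ideal B polyring" "A \<subseteq> B" "g ^ k \<in> B"
      unfolding B_def using ideal_adjoin[OF A(1)] subset_ideal_adjoin[OF A(1)] mem_ideal_adjoin[OF A(1)]
      by blast+
    have "f \<in> C 1" using fg by (simp add: C_def)
    then have "A \<subset> C k" using C_mono[OF k(1)] C(2) fg(2) by blast
    moreover have "A \<subset> B" using B fg(3) by blast
    ultimately obtain F G where F: "finite F" "\<forall>Q\<in>F. primary_ideal polyring Q" "\<Inter>F = C k"
      and G: "finite G" "\<forall>Q\<in>G. primary_ideal polyring Q" "\<Inter>G = B"
      using IH[OF C(1)] IH[OF B(1)] by metis
    have "C k \<inter> B \<subseteq> A"
    proof
      fix x assume x: "x \<in> C k \<inter> B"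
      then obtain a h where ah: "x = a + h * g ^ k" "a \<in> A" by (auto simp: B_def)
      have "x * g ^ k - a * g ^ k \<in> A"
        using x ideal_mult_right[OF A(1) ah(2)] by (auto simp: C_def intro: ideal_diff[OF A(1)])
      moreover have "x * g ^ k - a * g ^ k = h * g ^ (2 * k)"
        by (simp add: ah(1) distrib_right mult.assoc mult_2 power_add)
      ultimately have "h * g ^ (2 * k) \<in> A" by simp
      then have "h \<in> C k" unfolding stable[symmetric] by (simp add: C_def)
      then show "x \<in> A" using ah ideal_add[OF A(1)] by (simp add: C_def)
    qed
    then have "\<Inter>(F \<union> G) = A"
      using F(3) G(3) C(2) B(2) by (simp add: Inter_Un_distrib subset_antisym)
    then show ?thesis using F G by (intro exI[of _ "F \<union> G"]) auto
  qed
qed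

section \<open>The degree filtration\<close>

text \<open>Stated monomial by monomial, so that zero is no special case and closure properties
  follow from inclusions of supports.\<close>

lemma mem_filtP_iff:
  "f \<in> filtP i \<longleftrightarrow> (\<forall>t\<in>Poly_Mapping.keys f. int (\<Sum>i\<in>UNIV. Poly_Mapping.lookup t i) \<le> i)"
proof (cases "f = 0")
  case False
  let ?S = "(\<lambda>t. \<Sum>i\<in>UNIV. Poly_Mapping.lookup t i) ` Poly_Mapping.keys f"
  have S: "finite ?S" "?S \<noteq> {}" using False by auto
  have "f \<in> filtP i \<longleftrightarrow> int (Max ?S) \<le> i"
    using False by (simp add: filtP_def total_degree_def)
  also have "\<dots> \<longleftrightarrow> (\<forall>d\<in>?S. int d \<le> i)"
    using Max_in[OF S] Max_ge[OF S(1)] by (meson of_nat_le_iff order_trans)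
  finally show ?thesis by blast
qed (simp add: filtP_def)

lemma subspace_filtP: "mpoly.subspace (filtP i)"
  unfolding mpoly.subspace_def
proof (intro conjI allI ballI)
  show "0 \<in> filtP i" by (simp add: filtP_def)
  fix f :: "('n::finite, 'k::field) mpoly" assume f: "f \<in> filtP i"
  show "f + g \<in> filtP i" if "g \<in> filtP i" for g
    using f that Poly_Mapping.keys_add[of f g] by (auto simp: mem_filtP_iff)
  have "Poly_Mapping.keys (const_poly c * f) \<subseteq> Poly_Mapping.keys f" for c
    using keys_mult[of "const_poly c" f] by (auto simp: const_poly_def split: if_splits)
  then show "const_poly c * f \<in> filtP i" for c
    using f by (auto simp: mem_filtP_iff)
qed

lemma filtP_mono: "i \<le> j \<Longrightarrow> filtP i \<subseteq> filtP j"
  by (auto simp: filtP_def)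

lemma filtP_neg: "i < 0 \<Longrightarrow> filtP i = {0}"
  by (auto simp: filtP_def)

text \<open>The integers are not well-ordered, so \<open>LEAST\<close> needs a lower bound; shifting
  by \<open>m\<close> reduces the claim to natural numbers.\<close>

lemma Least_int:
  fixes m k :: int
  assumes "P k" and bound: "\<forall>i. P i \<longrightarrow> m \<le> i"
  shows "P (Least P)" and "\<And>i. P i \<Longrightarrow> Least P \<le> i"
proof -
  let ?n = "LEAST n. P (m + int n)"
  have "P (m + int (nat (k - m)))" using assms by simp
  then have n: "P (m + int ?n)" by (rule LeastI)
  have le: "m + int ?n \<le> i" if "P i" for i
  proof -
    have "P (m + int (nat (i - m)))" using that bound by simp
    then have "?n \<le> nat (i - m)" by (rule Least_le)
    then show ?thesis using bound that by fastforce
  qed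
  have "Least P = m + int ?n" by (rule Least_equality) (use n le in auto)
  with n le show "P (Least P)" "\<And>i. P i \<Longrightarrow> Least P \<le> i" by auto
qed

context
  fixes I :: "('n::finite, 'k::field) mpoly set"
  assumes I: "ideal I polyring" "I \<noteq> UNIV" "zero_dimensional I"
begin

text \<open>Take \<open>k\<close> with maximal Hilbert function value. For any \<open>f\<close>, the
  step at \<open>max k (total_degree f)\<close> contains the class of \<open>f\<close> and has the
  same dimension as the step at \<open>k\<close> inside it, so the two coincide.\<close>

lemma ex_filtR_eq_carrier: "\<exists>i. filtR I i = carrier (polyring Quot I)"
proof -
  obtain k where k: "\<And>j. affine_HF I (int j) \<le> affine_HF I (int k)"
    using ex_max_dimK[OF I, of 0 "\<lambda>k. filtP (int k)"] subspace_filtP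
    by (auto simp: affine_HF_def filtR_def)
  have "residue_class I f \<in> filtR I (int k)" for f
  proof -
    define j where "j = max k (total_degree f)"
    have sub: "filtR I (int k) \<subseteq> filtR I (int j)"
      unfolding filtR_def by (intro image_mono filtP_mono) (simp add: j_def)
    have "affine_HF I (int k) \<le> affine_HF I (int j)"
      using dimK_residue_class_image_mono(1)[OF I subspace_filtP subspace_filtP] sub
      by (simp add: affine_HF_def filtR_def)
    then have "filtR I (int k) = filtR I (int j)"
      using dimK_residue_class_image_mono(2)[OF I subspace_filtP subspace_filtP] sub k[of j]
      by (simp add: affine_HF_def filtR_def)
    moreover have "f \<in> filtP (int j)" by (auto simp: filtP_def j_def)
    ultimately show ?thesis by (auto simp: filtR_def)
  qed
  then have "filtR I (int k) = carrier (polyring Quot I)"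
    by (auto simp: filtR_def carrier_quotient[OF I(1)])
  then show ?thesis ..
qed

lemma affine_HF_eq_iff:
  "affine_HF I j = dimK I (carrier (polyring Quot I)) \<longleftrightarrow> filtR I j = carrier (polyring Quot I)"
  using dimK_residue_class_image_mono(2)[OF I subspace_filtP mpoly.subspace_UNIV, of j]
  by (auto simp: affine_HF_def filtR_def carrier_quotient[OF I(1)])

lemma filtR_mono: "i \<le> j \<Longrightarrow> filtR I i \<subseteq> filtR I j"
  unfolding filtR_def by (intro image_mono filtP_mono)

lemma filtR_subset_carrier: "filtR I i \<subseteq> carrier (polyring Quot I)"
  by (auto simp: filtR_def carrier_quotient[OF I(1)])

lemma residue_class_mem_filtR:
  assumes "f \<in> I"
  shows "residue_class I f \<in> filtR I i"
proof -
  have "residue_class I f = residue_class I 0"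
    using assms by (simp add: residue_class_eq_zero_iff[OF I(1)])
  moreover have "(0 :: ('n, 'k) mpoly) \<in> filtP i" by (simp add: filtP_def)
  ultimately show ?thesis by (auto simp: filtR_def)
qed

lemma filtR_nonneg: "residue_class I f \<in> filtR I i \<Longrightarrow> f \<notin> I \<Longrightarrow> 0 \<le> i"
proof (rule ccontr)
  assume "residue_class I f \<in> filtR I i" "f \<notin> I" "\<not> 0 \<le> i"
  then have "residue_class I f = residue_class I 0" by (simp add: filtR_def filtP_neg)
  with \<open>f \<notin> I\<close> show False by (simp add: residue_class_eq_zero_iff[OF I(1)])
qed

text \<open>By monotonicity, a step that is all of R stays so from there on. The least such index
  exists because negative steps are zero while the class of 1 is not.\<close>

lemma filtR_reg_index:
  shows "filtR I (reg_index I) = carrier (polyring Quot I)"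
    and "filtR I (reg_index I - 1) \<noteq> carrier (polyring Quot I)"
proof -
  let ?P = "\<lambda>i. \<forall>j\<ge>i. filtR I j = carrier (polyring Quot I)"
  have r: "reg_index I = Least ?P"
    unfolding reg_index_def affine_HF_eq_iff ..
  obtain k where "filtR I k = carrier (polyring Quot I)" using ex_filtR_eq_carrier ..
  then have k: "?P k"
    using filtR_mono filtR_subset_carrier by blast
  have one: "(1 :: ('n, 'k) mpoly) \<notin> I" using I ideal_eq_UNIV_iff[OF I(1)] by simp
  have bound: "\<forall>i. ?P i \<longrightarrow> 0 \<le> i"
    using filtR_nonneg[OF _ one] residue_class_closed[OF I(1), of 1] by blast
  note L = Least_int[of ?P, OF k bound]
  show eq: "filtR I (reg_index I) = carrier (polyring Quot I)"
    using L(1) unfolding r by blast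
  show "filtR I (reg_index I - 1) \<noteq> carrier (polyring Quot I)"
  proof
    assume a: "filtR I (reg_index I - 1) = carrier (polyring Quot I)"
    have "?P (reg_index I - 1)"
    proof (intro allI impI)
      fix j assume "reg_index I - 1 \<le> j"
      then have "j = reg_index I - 1 \<or> reg_index I \<le> j" by linarith
      then show "filtR I j = carrier (polyring Quot I)"
        using a L(1) unfolding r by blast
    qed
    from L(2)[OF this] show False by (simp add: r)
  qed
qed

text \<open>The step at \<open>reg_index I\<close> is all of R, so no order exceeds it, and an
  element has this order precisely when the preceding step misses it.\<close>

lemma filt_ord_bounds:
  assumes "f \<notin> I"
  shows "0 \<le> filt_ord I (residue_class I f)" and "filt_ord I (residue_class I f) \<le> reg_index I"
    and "filt_ord I (residue_class I f) = reg_index I \<longleftrightarrow>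
      residue_class I f \<notin> filtR I (reg_index I - 1)"
proof -
  let ?P = "\<lambda>i. residue_class I f \<in> filtR I i"
  have ord: "filt_ord I (residue_class I f) = Least ?P" by (simp add: filt_ord_def)
  have P: "?P (reg_index I)" by (simp add: filtR_reg_index residue_class_closed[OF I(1)])
  have bound: "\<forall>i. ?P i \<longrightarrow> 0 \<le> i" using filtR_nonneg[OF _ assms] by blast
  note L = Least_int[of ?P, OF P bound]
  show "0 \<le> filt_ord I (residue_class I f)"
    unfolding ord by (rule filtR_nonneg[OF L(1) assms])
  show le: "filt_ord I (residue_class I f) \<le> reg_index I"
    unfolding ord by (rule L(2)[OF P])
  show "filt_ord I (residue_class I f) = reg_index I \<longleftrightarrow> residue_class I f \<notin> filtR I (reg_index I - 1)"
  proof
    assume "filt_ord I (residue_class I f) = reg_index I"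
    then show "residue_class I f \<notin> filtR I (reg_index I - 1)"
      using L(2)[of "reg_index I - 1"] ord by auto
  next
    assume "residue_class I f \<notin> filtR I (reg_index I - 1)"
    then have "\<not> Least ?P \<le> reg_index I - 1" using L(1) filtR_mono by blast
    then show "filt_ord I (residue_class I f) = reg_index I" using le ord by simp
  qed
qed

text \<open>The image of \<open>J\<close> may be infinite, but its orders lie in
  \<open>{0..reg_index I}\<close>, so the maximum exists and equals the upper bound exactly when
  some class attains it. The zero class lies in every step and may be readmitted at the end.\<close>

lemma reg_index_ideal_eq_iff:
  assumes J: "ideal J polyring" "I \<subset> J"
  shows "reg_index_ideal I J = reg_index I \<longleftrightarrow>
    \<not> residue_class I ` J \<subseteq> filtR I (reg_index I - 1)"
proof -
  let ?S = "residue_class I ` J - {\<zero>\<^bsub>polyring Quot I\<^esub>}"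
  have S: "?S = residue_class I ` (J - I)"
  proof (intro equalityI subsetI)
    fix x assume "x \<in> ?S"
    then obtain f where "x = residue_class I f" "f \<in> J" "residue_class I f \<noteq> residue_class I 0"
      by (auto simp only: residue_class_zero[OF I(1)])
    then show "x \<in> residue_class I ` (J - I)"
      by (simp add: residue_class_eq_zero_iff[OF I(1)])
  next
    fix x assume "x \<in> residue_class I ` (J - I)"
    then obtain f where "x = residue_class I f" "f \<in> J" "f \<notin> I" by blast
    then show "x \<in> ?S"
      by (simp add: residue_class_zero[OF I(1)] residue_class_eq_zero_iff[OF I(1)])
  qed
  then have range: "filt_ord I ` ?S \<subseteq> {0..reg_index I}" using filt_ord_bounds by auto
  have fin: "finite (filt_ord I ` ?S)" by (rule finite_subset[OF range]) simp
  have le: "\<forall>x\<in>filt_ord I ` ?S. x \<le> reg_index I" using range by fastforce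
  have "filt_ord I ` ?S \<noteq> {}" using J(2) unfolding S by blast
  then have "reg_index_ideal I J = reg_index I \<longleftrightarrow> reg_index I \<in> filt_ord I ` ?S"
    unfolding reg_index_ideal_def Max_eq_iff[OF fin \<open>filt_ord I ` ?S \<noteq> {}\<close>] using le by blast
  also have "\<dots> \<longleftrightarrow> (\<exists>f\<in>J - I. residue_class I f \<notin> filtR I (reg_index I - 1))"
  proof -
    have "reg_index I \<in> filt_ord I ` ?S \<longleftrightarrow>
        (\<exists>f\<in>J - I. filt_ord I (residue_class I f) = reg_index I)"
      unfolding S by (metis (no_types, opaque_lifting) image_iff)
    then show ?thesis using filt_ord_bounds(3) by (metis DiffD2)
  qed
  also have "\<dots> \<longleftrightarrow> \<not> residue_class I ` J \<subseteq> filtR I (reg_index I - 1)"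
    using residue_class_mem_filtR by blast
  finally show ?thesis .
qed

end

section \<open>The Cayley-Bacharach property and the canonical module\<close>

context
  fixes I :: "('n::finite, 'k::field) mpoly set"
  assumes I: "ideal I polyring" "I \<noteq> UNIV" "zero_dimensional I"
begin

interpretation R: cring "polyring Quot I"
  by (rule quotient_cring[OF I(1)])

section \<open>Minimal ideals of R and minimal divisors\<close>

text \<open>An ideal of least dimension modulo \<open>I\<close> among those between \<open>I\<close>
  and \<open>B\<close> works: a smaller one strictly above \<open>I\<close> would have smaller
  dimension.\<close>

lemma ex_minimal_ideal:
  assumes B: "ideal B polyring" "I \<subset> B"
  obtains J where "ideal J polyring" "I \<subset> J" "J \<subseteq> B"
    "\<forall>J'. ideal J' polyring \<longrightarrow> I \<subset> J' \<longrightarrow> J' \<subseteq> J \<longrightarrow> J' = J"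
proof -
  let ?P = "\<lambda>J. ideal J polyring \<and> I \<subset> J \<and> J \<subseteq> B"
  let ?d = "\<lambda>J. dimK I (residue_class I ` J)"
  have "?P B" using B by simp
  from ex_has_least_nat[of ?P, OF this, of ?d]
  obtain J where J: "?P J" and min: "\<forall>J'. ?P J' \<longrightarrow> ?d J \<le> ?d J'" by blast
  have "J' = J" if J': "ideal J' polyring" "I \<subset> J'" "J' \<subseteq> J" for J'
  proof (rule ccontr)
    assume "J' \<noteq> J"
    then have "?d J' < ?d J"
      using J J' by (intro dimK_residue_class_image_strict_mono[OF I]) (auto intro: ideal_imp_subspace)
    moreover have "?P J'" using J J' by auto
    then have "?d J \<le> ?d J'" by (rule min[rule_format])
    ultimately show False by simp
  qed
  with J show ?thesis by (intro that[of J]) auto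
qed

text \<open>By minimality every element of \<open>J\<close> outside \<open>I\<close> generates
  \<open>J\<close> modulo \<open>I\<close>. Hence \<open>M\<close>, the annihilator of one
  generator, kills all of J/I, and every component either contains \<open>J\<close> or has radical
  \<open>M\<close>.\<close>

lemma minimal_ideal_is_minimal_divisor:
  assumes \<Q>: "primary_decomposition I \<Q>"
    and J: "ideal J polyring" "I \<subset> J"
    and min: "\<And>J'. ideal J' polyring \<Longrightarrow> I \<subset> J' \<Longrightarrow> J' \<subseteq> J \<Longrightarrow> J' = J"
  shows "\<exists>Q\<in>\<Q>. is_minimal_divisor I \<Q> Q J"
proof -
  have prim: "primary_ideal polyring Q" and idl: "ideal Q polyring" if "Q \<in> \<Q>" for Q
    using \<Q> that by (auto simp: primary_decomposition_def primary_ideal_iff)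
  have Inter: "\<Inter>\<Q> = I" and inj: "inj_on (ideal_radical polyring) \<Q>"
    using \<Q> by (auto simp: primary_decomposition_def)
  obtain f where f: "f \<in> J" "f \<notin> I" using J(2) by blast
  have principal: "{a + h * f' | a h. a \<in> I} = J" if "f' \<in> J" "f' \<notin> I" for f'
  proof (rule min)
    show "ideal {a + h * f' | a h. a \<in> I} polyring" by (rule ideal_adjoin[OF I(1)])
    show "I \<subset> {a + h * f' | a h. a \<in> I}"
      using subset_ideal_adjoin[OF I(1), of f'] mem_ideal_adjoin[OF I(1), of f'] that(2) by blast
    show "{a + h * f' | a h. a \<in> I} \<subseteq> J"
      using J that(1) ideal_add[OF J(1)] ideal_mult_left[OF J(1)] by blast
  qed
  define M where "M = {h. h * f \<in> I}"
  have MJ: "m * x \<in> I" if m: "m \<in> M" and x: "x \<in> J" for m x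
  proof -
    obtain a h where "x = a + h * f" "a \<in> I" using x principal[OF f] by blast
    moreover from this have "m * a + h * (m * f) \<in> I"
      using m by (intro ideal_add[OF I(1) ideal_mult_left[OF I(1)] ideal_mult_left[OF I(1)]])
        (auto simp: M_def)
    ultimately show ?thesis by (simp add: distrib_left mult.left_commute)
  qed
  \<comment> \<open>In effect \<open>M\<close> is maximal: for \<open>g\<close> outside
    \<open>M\<close>, the element \<open>f\<close> lies in I + (g f), which gives an inverse
    \<open>h\<close> of \<open>g\<close> modulo \<open>M\<close>. If \<open>g\<close> were in the
    radical of \<open>Q\<close>, then powers of both \<open>g\<close> and \<open>1 - h * g\<close>
    would lie in \<open>Q\<close>, and with them 1.\<close>
  have rad_eq: "ideal_radical polyring Q = M"
    if Q: "Q \<in> \<Q>" and sub: "M \<subseteq> ideal_radical polyring Q" for Q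
  proof (rule equalityI[OF _ sub], rule subsetI, rule ccontr)
    fix g assume g: "g \<in> ideal_radical polyring Q" "g \<notin> M"
    have "g * f \<in> J" "g * f \<notin> I" using f g(2) ideal_mult_left[OF J(1)] by (auto simp: M_def)
    from principal[OF this] f(1) obtain a h where "f = a + h * (g * f)" "a \<in> I" by blast
    moreover from this have "f - h * (g * f) = a" by (metis add_diff_cancel_right')
    ultimately have "(1 - h * g) * f \<in> I" by (simp add: left_diff_distrib mult.assoc)
    then have "1 - h * g \<in> ideal_radical polyring Q" using sub by (auto simp: M_def)
    then obtain a where a: "(1 - h * g) ^ a \<in> Q" by (auto simp: mem_ideal_radical_iff)
    obtain b where b: "g ^ b \<in> Q" using g(1) by (auto simp: mem_ideal_radical_iff)
    \<comment> \<open>Two geometric sums: the first turns \<open>(1 - h * g) ^ a\<close> into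
      \<open>1 - g * k\<close>, the second makes \<open>1 - (g * k) ^ b\<close> a multiple of
      that.\<close>
    obtain k where k: "1 - (1 - h * g) ^ a = g * k"
      using one_diff_power_eq[of "1 - h * g" a] by (auto simp: mult.assoc mult.left_commute)
    obtain l where l: "1 - (g * k) ^ b = (1 - g * k) * l"
      using one_diff_power_eq[of "g * k" b] by auto
    have "1 - g * k \<in> Q" using a by (simp flip: k)
    then have "1 - (g * k) ^ b \<in> Q" unfolding l by (rule ideal_mult_right[OF idl[OF Q]])
    moreover have "(g * k) ^ b \<in> Q"
      unfolding power_mult_distrib by (rule ideal_mult_right[OF idl[OF Q] b])
    ultimately have "1 - (g * k) ^ b + (g * k) ^ b \<in> Q" by (rule ideal_add[OF idl[OF Q]])
    then show False using prim[OF Q] by (simp add: primary_ideal_iff)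
  qed
  \<comment> \<open>Some \<open>m\<close> in \<open>M\<close> lies outside the radical of
    \<open>Q\<close>. It multiplies \<open>J\<close> into \<open>I\<close>, hence into
    \<open>Q\<close>, and primarity puts \<open>J\<close> into \<open>Q\<close>.\<close>
  have J_sub: "J \<subseteq> Q \<or> ideal_radical polyring Q = M" if Q: "Q \<in> \<Q>" for Q
  proof (rule disjCI)
    assume "ideal_radical polyring Q \<noteq> M"
    then obtain m where m: "m \<in> M" "m \<notin> ideal_radical polyring Q" using rad_eq[OF Q] by blast
    show "J \<subseteq> Q"
    proof
      fix x assume "x \<in> J"
      then have "x * m \<in> Q" using MJ[OF m(1), of x] Inter Q unfolding mult.commute[of x m] by blast
      then show "x \<in> Q" using prim[OF Q] m(2) by (auto simp: primary_ideal_iff mem_ideal_radical_iff)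
    qed
  qed
  obtain Q where Q: "Q \<in> \<Q>" "\<not> J \<subseteq> Q" using J(2) Inter by blast
  have rad: "ideal_radical polyring Q = M" using J_sub Q by blast
  \<comment> \<open>Distinct components have distinct radicals, so \<open>Q\<close> is the only one
    with radical \<open>M\<close>.\<close>
  have "J \<subseteq> Q'" if "Q' \<in> \<Q> - {Q}" for Q'
    using J_sub[of Q'] that rad inj Q(1) by (auto dest: inj_onD)
  then have J_Inter: "J \<subseteq> \<Inter>(\<Q> - {Q})" by blast
  define Q' where "Q' = {q + h * f | q h. q \<in> Q}"
  have Q': "ideal Q' polyring" "Q \<subseteq> Q'" "f \<in> Q'"
    unfolding Q'_def using ideal_adjoin[OF idl[OF Q(1)]] subset_ideal_adjoin[OF idl[OF Q(1)]]
      mem_ideal_adjoin[OF idl[OF Q(1)]] by blast+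
  have "I \<subseteq> Q" using Inter Q(1) by blast
  have "f \<notin> Q"
  proof
    assume "f \<in> Q"
    then have "J \<subseteq> Q"
      using principal[OF f] \<open>I \<subseteq> Q\<close> ideal_add[OF idl[OF Q(1)]] ideal_mult_left[OF idl[OF Q(1)]]
      by blast
    with Q(2) show False ..
  qed
  have "J = \<Inter>(\<Q> - {Q}) \<inter> Q'"
  proof
    show "J \<subseteq> \<Inter>(\<Q> - {Q}) \<inter> Q'"
      using J_Inter principal[OF f] \<open>I \<subseteq> Q\<close> by (auto simp: Q'_def)
    show "\<Inter>(\<Q> - {Q}) \<inter> Q' \<subseteq> J"
    proof
      fix x assume x: "x \<in> \<Inter>(\<Q> - {Q}) \<inter> Q'"
      then obtain q h where qh: "x = q + h * f" "q \<in> Q" by (auto simp: Q'_def)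
      have hf: "h * f \<in> J" using f(1) by (rule ideal_mult_left[OF J(1)])
      \<comment> \<open>The modular law: in the components other than \<open>Q\<close>, both
        \<open>x\<close> and \<open>h * f\<close> are present, hence so is their difference
        \<open>q\<close>; in \<open>Q\<close> it is by choice. So \<open>q\<close> is in
        \<open>I\<close>.\<close>
      have "q \<in> P" if "P \<in> \<Q>" for P
      proof (cases "P = Q")
        case False
        then have "x - h * f \<in> P" using x J_Inter hf that by (intro ideal_diff[OF idl[OF that]]) auto
        then show ?thesis by (simp add: qh)
      qed (simp add: qh)
      then have "q \<in> J" using Inter J(2) by blast
      then show "x \<in> J" unfolding qh(1) using hf by (rule ideal_add[OF J(1)])
    qed
  qed
  then have "is_divisor \<Q> Q J"
    unfolding is_divisor_def using Q' \<open>f \<notin> Q\<close> by (intro exI[of _ Q']) auto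
  moreover have "dimK I (residue_class I ` J) = dimK M (carrier (polyring Quot M))"
    using dimK_principal[OF I f(2) M_def] principal[OF f] by simp
  ultimately have "is_minimal_divisor I \<Q> Q J"
    by (simp add: is_minimal_divisor_def Let_def rad)
  with Q(1) show ?thesis ..
qed

text \<open>Strictness is read off from dimensions: J/I has the dimension of P/M for the radical M
  of \<open>Q\<close>, and P/M is nonzero because 1 is not in M.\<close>

lemma minimal_divisor_ideal:
  assumes \<Q>: "primary_decomposition I \<Q>" and Q: "Q \<in> \<Q>" and J: "is_minimal_divisor I \<Q> Q J"
  shows "ideal J polyring" and "I \<subset> J"
proof -
  have idl: "ideal Q polyring" if "Q \<in> \<Q>" for Q
    using \<Q> that by (auto simp: primary_decomposition_def primary_ideal_iff)
  have Inter: "\<Inter>\<Q> = I" using \<Q> by (auto simp: primary_decomposition_def)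
  obtain Q' where Q': "ideal Q' polyring" "Q \<subset> Q'" "J = \<Inter>(\<Q> - {Q}) \<inter> Q'"
    using J by (auto simp: is_minimal_divisor_def is_divisor_def)
  show iJ: "ideal J polyring"
    unfolding Q'(3) by (intro ideal_Int ideal_Inter idl Q'(1)) auto
  have sub: "I \<subseteq> J" using Q' Q Inter by auto
  let ?M = "ideal_radical polyring Q"
  have "J \<noteq> I"
  proof
    assume "J = I"
    have prim: "primary_ideal polyring Q" using \<Q> Q by (simp add: primary_decomposition_def)
    have M: "ideal ?M polyring" by (rule ideal_ideal_radical[OF idl[OF Q]])
    have "1 \<notin> ?M" using prim by (simp add: mem_ideal_radical_iff primary_ideal_iff)
    then have M': "?M \<noteq> UNIV" by blast
    have "I \<subseteq> ?M"
    proof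
      fix x assume "x \<in> I"
      then have "x ^ 1 \<in> Q" using Inter Q by auto
      then show "x \<in> ?M" unfolding mem_ideal_radical_iff ..
    qed
    interpret RM: cring "polyring Quot ?M" by (rule quotient_cring[OF M])
    have "residue_class I ` I = {\<zero>\<^bsub>polyring Quot I\<^esub>}"
    proof -
      have "residue_class I ` I = (\<lambda>_. residue_class I 0) ` I"
        by (intro image_cong refl) (simp add: residue_class_eq_zero_iff[OF I(1)])
      then show ?thesis
        using ideal_zero[OF I(1)] by (simp add: residue_class_zero[OF I(1)] image_constant)
    qed
    then have "dimK I (residue_class I ` J) = 0"
      using R.dimI[OF base_field_subfield[OF I(1,2)] R.zero_dim] \<open>J = I\<close>
      by (simp add: dimK_def over_def)
    then have "dimK ?M (carrier (polyring Quot ?M)) = 0"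
      using J by (simp add: is_minimal_divisor_def Let_def)
    \<comment> \<open>A vanishing \<open>dimK\<close> is conclusive only for a space of finite
      dimension; P/M inherits finiteness from R.\<close>
    moreover have "RM.dimension (dimK ?M (carrier (polyring Quot ?M))) (base_field ?M) (carrier (polyring Quot ?M))"
      using zero_dimensional_superset[OF I(1) M M' \<open>I \<subseteq> ?M\<close> I(3)]
        RM.finite_dimensionE[OF base_field_subfield[OF M M']]
      by (simp add: dimK_def over_def zero_dimensional_def)
    ultimately have "carrier (polyring Quot ?M) = {\<zero>\<^bsub>polyring Quot ?M\<^esub>}"
      using RM.dimension_zero[OF base_field_subfield[OF M M']] by simp
    then have "residue_class ?M 1 = residue_class ?M 0"
      using residue_class_closed[OF M, of 1] residue_class_zero[OF M] by auto
    with \<open>1 \<notin> ?M\<close> show False by (simp add: residue_class_eq_zero_iff[OF M])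
  qed
  with sub show "I \<subset> J" by blast
qed

section \<open>Linear forms on R and the annihilator\<close>

text \<open>The form is evaluated at a chosen representative of each class. The choice is immaterial
  because \<open>\<alpha>\<close> vanishes on differences of representatives.\<close>

lemma ex_linear_form:
  assumes lin: "Vector_Spaces.linear (\<lambda>c (f :: ('n, 'k) mpoly). const_poly c * f) (*) \<alpha>"
    and zero: "\<And>f. f \<in> I \<Longrightarrow> \<alpha> f = 0"
  shows "\<exists>\<phi>\<in>linear_forms I. \<forall>f. \<phi> (residue_class I f) = \<alpha> f"
proof
  interpret \<alpha>: Vector_Spaces.linear "\<lambda>c (f :: ('n, 'k) mpoly). const_poly c * f" "(*)" \<alpha> by (rule lin)
  define \<phi> where "\<phi> = (\<lambda>C\<in>carrier (polyring Quot I). \<alpha> (SOME f. residue_class I f = C))"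
  show \<phi>: "\<forall>f. \<phi> (residue_class I f) = \<alpha> f"
  proof
    fix f
    have "residue_class I (SOME h. residue_class I h = residue_class I f) = residue_class I f"
      by (rule someI) (rule refl)
    then have "\<alpha> ((SOME h. residue_class I h = residue_class I f) - f) = 0"
      by (intro zero) (simp add: residue_class_eq_iff[OF I(1)])
    then show "\<phi> (residue_class I f) = \<alpha> f"
      by (simp add: \<phi>_def residue_class_closed[OF I(1)] \<alpha>.diff)
  qed
  have "\<phi> \<in> extensional (carrier (polyring Quot I))" by (simp add: \<phi>_def)
  with \<phi> show "\<phi> \<in> linear_forms I"
    by (auto simp: linear_forms_def carrier_quotient[OF I(1)] residue_class_add[OF I(1)]
        residue_class_mult[OF I(1)] \<alpha>.add \<alpha>.scale)
qed

text \<open>The index shift is \<open>- (- r) - 1 = r - 1\<close>, which is the last filtration step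
  below R.\<close>

lemma filtG_reg_index:
  "filtG I (- reg_index I) = {\<phi> \<in> linear_forms I. \<forall>h\<in>filtR I (reg_index I - 1). \<phi> h = 0}"
  by (simp add: filtG_def canonical_module_def)

lemma smult_eq_zero_iff:
  "h \<odot>\<^bsub>canonical_module I\<^esub> \<phi> = \<zero>\<^bsub>canonical_module I\<^esub> \<longleftrightarrow>
    (\<forall>g. \<phi> (h \<otimes>\<^bsub>polyring Quot I\<^esub> residue_class I g) = 0)"
  by (auto simp: canonical_module_def fun_eq_iff carrier_quotient[OF I(1)] restrict_def)

lemma annihilates_filtG_iff:
  "(\<forall>\<phi>\<in>filtG I (- reg_index I).
      residue_class I f \<odot>\<^bsub>canonical_module I\<^esub> \<phi> = \<zero>\<^bsub>canonical_module I\<^esub>) \<longleftrightarrow>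
    (\<forall>g. residue_class I (f * g) \<in> filtR I (reg_index I - 1))" (is "?l \<longleftrightarrow> ?r")
proof
  assume ?r
  then show ?l
    by (auto simp: smult_eq_zero_iff filtG_reg_index residue_class_mult[OF I(1)])
next
  assume l: ?l
  show ?r
  proof (rule allI, rule ccontr)
    fix g
    \<comment> \<open>The preimage of the filtration step in P. Separation takes place in P, and the
      separating form descends to R because the preimage contains \<open>I\<close>.\<close>
    let ?V = "{h. residue_class I h \<in> residue_class I ` filtP (reg_index I - 1)}"
    have V: "mpoly.subspace ?V"
      by (rule subspace_vimage_residue_class[OF I(1) subspace_filtP])
    assume "residue_class I (f * g) \<notin> filtR I (reg_index I - 1)"
    then have "f * g \<notin> ?V" by (simp add: filtR_def)
    from ex_separating_form[OF V this] obtain \<alpha> where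
      lin: "Vector_Spaces.linear (\<lambda>c (f :: ('n, 'k) mpoly). const_poly c * f) (*) \<alpha>"
      and \<alpha>: "\<And>v. v \<in> ?V \<Longrightarrow> \<alpha> v = 0" "\<alpha> (f * g) = 1"
      by blast
    have "I \<subseteq> ?V"
      using residue_class_mem_filtR[OF I] by (auto simp: filtR_def)
    then obtain \<phi> where \<phi>: "\<phi> \<in> linear_forms I" "\<forall>f. \<phi> (residue_class I f) = \<alpha> f"
      using ex_linear_form[OF lin] \<alpha>(1) by blast
    have "\<phi> \<in> filtG I (- reg_index I)"
      using \<phi> \<alpha>(1) by (auto simp: filtG_reg_index filtR_def)
    with l have "\<phi> (residue_class I f \<otimes>\<^bsub>polyring Quot I\<^esub> residue_class I g) = 0"
      by (simp add: smult_eq_zero_iff)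
    then show False using \<phi>(2) \<alpha>(2) by (simp add: residue_class_mult[OF I(1)])
  qed
qed

lemma nondegenerate_mult_iff_annihilator:
  "nondegenerate_mult (polyring Quot I) (canonical_module I) (filtG I i) \<longleftrightarrow>
    annihilator (polyring Quot I) (canonical_module I) (filtG I i) = {\<zero>\<^bsub>polyring Quot I\<^esub>}"
proof -
  interpret M: Module.module "polyring Quot I" "canonical_module I"
    by (rule canonical_module_module[OF I(1)])
  have sub: "\<phi> \<in> carrier (canonical_module I)" if "\<phi> \<in> filtG I i" for \<phi>
    using that by (simp add: filtG_def)
  have "\<phi> = \<zero>\<^bsub>canonical_module I\<^esub>"
    if "\<phi> \<in> filtG I i" "\<forall>h\<in>carrier (polyring Quot I). h \<odot>\<^bsub>canonical_module I\<^esub> \<phi> = \<zero>\<^bsub>canonical_module I\<^esub>" for \<phi>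
    using that(2) R.one_closed M.smult_one[OF sub[OF that(1)]] by metis
  moreover have "\<zero>\<^bsub>polyring Quot I\<^esub> \<odot>\<^bsub>canonical_module I\<^esub> \<phi> = \<zero>\<^bsub>canonical_module I\<^esub>"
    if "\<phi> \<in> filtG I i" for \<phi>
    using M.smult_l_null[OF sub[OF that]] .
  ultimately show ?thesis
    unfolding nondegenerate_mult_def annihilator_def using R.zero_closed by blast
qed

lemma annihilator_eq_zero_iff:
  "annihilator (polyring Quot I) (canonical_module I) (filtG I (- reg_index I)) = {\<zero>\<^bsub>polyring Quot I\<^esub>} \<longleftrightarrow>
    (\<forall>f. (\<forall>g. residue_class I (f * g) \<in> filtR I (reg_index I - 1)) \<longrightarrow> f \<in> I)"
proof -
  interpret M: Module.module "polyring Quot I" "canonical_module I"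
    by (rule canonical_module_module[OF I(1)])
  let ?A = "annihilator (polyring Quot I) (canonical_module I) (filtG I (- reg_index I))"
  have mem: "residue_class I f \<in> ?A \<longleftrightarrow> (\<forall>g. residue_class I (f * g) \<in> filtR I (reg_index I - 1))" for f
    by (simp add: annihilator_def annihilates_filtG_iff residue_class_closed[OF I(1)])
  have "\<zero>\<^bsub>polyring Quot I\<^esub> \<in> ?A"
    using M.smult_l_null by (auto simp: annihilator_def filtG_def)
  moreover have "?A \<subseteq> range (residue_class I)"
    by (auto simp: annihilator_def carrier_quotient[OF I(1)])
  ultimately have "?A = {\<zero>\<^bsub>polyring Quot I\<^esub>} \<longleftrightarrow>
      (\<forall>f. residue_class I f \<in> ?A \<longrightarrow> residue_class I f = \<zero>\<^bsub>polyring Quot I\<^esub>)"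
    by blast
  then show ?thesis
    by (simp only: mem residue_class_zero[OF I(1)] residue_class_eq_zero_iff[OF I(1)])
qed

text \<open>The right-hand side says that the step below \<open>reg_index I\<close> contains no
  nonzero principal ideal, hence no nonzero ideal of R. A minimal divisor is nonzero and so is not
  contained in it; conversely, a minimal ideal inside an offending principal one is a minimal
  divisor.\<close>

lemma cayley_bacharach_iff:
  "cayley_bacharach I \<longleftrightarrow>
    (\<forall>f. (\<forall>g. residue_class I (f * g) \<in> filtR I (reg_index I - 1)) \<longrightarrow> f \<in> I)" (is "?l \<longleftrightarrow> ?r")
proof
  assume r: ?r
  show ?l
    unfolding cayley_bacharach_def
  proof (intro allI impI ballI)
    fix \<Q> Q J
    assume "primary_decomposition I \<Q>" "Q \<in> \<Q>" "is_minimal_divisor I \<Q> Q J"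
    note J = minimal_divisor_ideal[OF this]
    obtain f where f: "f \<in> J" "f \<notin> I" using J(2) by blast
    with r obtain g where "residue_class I (f * g) \<notin> filtR I (reg_index I - 1)" by blast
    moreover have "f * g \<in> J" using f(1) by (rule ideal_mult_right[OF J(1)])
    ultimately have "\<not> residue_class I ` J \<subseteq> filtR I (reg_index I - 1)" by blast
    then show "reg_index_ideal I J = reg_index I"
      by (rule iffD2[OF reg_index_ideal_eq_iff[OF I J]])
  qed
next
  assume l: ?l
  show ?r
  proof (intro allI impI, rule ccontr)
    fix f assume f: "\<forall>g. residue_class I (f * g) \<in> filtR I (reg_index I - 1)" "f \<notin> I"
    let ?B = "{a + h * f | a h. a \<in> I}"
    have B: "ideal ?B polyring" by (rule ideal_adjoin[OF I(1)])
    have B': "I \<subset> ?B"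
      using subset_ideal_adjoin[OF I(1), of f] mem_ideal_adjoin[OF I(1), of f] f(2) by blast
    obtain J where J: "ideal J polyring" "I \<subset> J" "J \<subseteq> ?B"
      and min: "\<forall>J'. ideal J' polyring \<longrightarrow> I \<subset> J' \<longrightarrow> J' \<subseteq> J \<longrightarrow> J' = J"
      by (rule ex_minimal_ideal[OF B B'])
    \<comment> \<open>The property speaks about all primary decompositions and yields information
      only once one is known to exist.\<close>
    obtain \<Q> where \<Q>: "primary_decomposition I \<Q>"
    proof -
      obtain F where "finite F" "\<forall>Q\<in>F. primary_ideal polyring Q" "\<Inter>F = I"
        using ex_finite_primary_family[OF I I(1) subset_refl] by blast
      then have "\<exists>\<Q>. primary_decomposition I \<Q>" by (intro ex_primary_decomposition) auto
      then show ?thesis using that by blast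
    qed
    obtain Q where "Q \<in> \<Q>" "is_minimal_divisor I \<Q> Q J"
      using minimal_ideal_is_minimal_divisor[OF \<Q> J(1,2) min[rule_format]] by blast
    with l \<Q> have "reg_index_ideal I J = reg_index I" by (simp add: cayley_bacharach_def)
    then have "\<not> residue_class I ` J \<subseteq> filtR I (reg_index I - 1)"
      by (rule iffD1[OF reg_index_ideal_eq_iff[OF I J(1,2)]])
    moreover have "residue_class I ` J \<subseteq> filtR I (reg_index I - 1)"
    proof
      fix y assume "y \<in> residue_class I ` J"
      then obtain a h where y: "y = residue_class I (a + h * f)" "a \<in> I" using J(3) by blast
      then have "y = residue_class I (f * h)"
        by (simp add: residue_class_eq_iff[OF I(1)] mult.commute)
      then show "y \<in> filtR I (reg_index I - 1)" using f(1) by blast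
    qed
    ultimately show False by blast
  qed
qed

end

theorem theorem4p5:
  fixes I :: "('n::finite, 'k::field) mpoly set"
  assumes "ideal I polyring" and "I \<noteq> UNIV" and "zero_dimensional I"
  shows "(cayley_bacharach I \<longleftrightarrow>
            nondegenerate_mult (polyring Quot I) (canonical_module I) (filtG I (- reg_index I))) \<and>
         (nondegenerate_mult (polyring Quot I) (canonical_module I) (filtG I (- reg_index I)) \<longleftrightarrow>
            annihilator (polyring Quot I) (canonical_module I) (filtG I (- reg_index I))
              = {\<zero>\<^bsub>polyring Quot I\<^esub>})"
  unfolding nondegenerate_mult_iff_annihilator[OF assms] annihilator_eq_zero_iff[OF assms]
    cayley_bacharach_iff[OF assms]
  by (intro conjI refl)

end
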